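(* Let $r\ge 1$ be an integer. Assume that, as $n\to\infty$, $n p_n^*\to\lambda$ for some (finite) $\lambda\ge 0$ and that $n^{r+1}\,\mathbb{E}\,p_{X_n}^r\to\infty$. Then $$\frac{V_{n,r}-\mathbb{E}\,V_{n,r}}{\sqrt{\mathrm{Var}\,V_{n,r}}}\stackrel{d}{\to}\mathrm{N}(0,1)\qquad\text{as } n\to\infty.$$
   Context: Model. For every $n\ge 1$, let $X_{n,1},\ldots,X_{n,n}$ be iid random variables with values in a (finite or infinite) set $M_n\subset\mathbb{N}=\{1,2,\ldots\}$, with common distribution $p_{n,m}=\mathbb{P}(X_{n,1}=m)$, $m\in M_n$ ($X_{n,j}$ is the box selected for the $j$th of $n$ balls). For $k\in\{1,\ldots,n+1\}$ and $m\in M_n$ let $N_{n,k}(m)=\sum_{j=1}^{k-1} I_{\{X_{n,j}=m\}}$, where $I_{\{\cdot\}}$ denotes an indicator. Given a positive integer $r$ (the capacity of each box), let $Y_{n,k}=\sum_{m\in M_n} I_{\{X_{n,k}=m\}}I_{\{N_{n,k}(m)\ge r\}}$ for $k=1,\ldots,n$, and define the overflow $V_{n,r}=\sum_{k=1}^n Y_{n,k}$. Notation. $p_n^*=\sup_{m\in M_n}p_{n,m}$. $X_n$ denotes a random variable such that $X_n,X_{n,1},\ldots,X_{n,n}$ are iid, and $p_{X_n}$ stands for $p_{n,X_n}$; thus $\mathbb{E}\,p_{X_n}^s=\sum_{m\in M_n}p_{n,m}^{s+1}$. $\mathrm{N}(0,1)$ is the standard normal distribution, and $\stackrel{d}{\to}$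 is convergence in distribution. *)

theory Defs
  imports "HOL-Probability.Probability"
begin

text \<open>
  The definitions below describe one row of the triangular array: \<open>P\<close> is the probability space of
  the row, \<open>B\<close> its set of boxes and \<open>X j\<close> the box selected for the \<open>j\<close>th ball, where the balls
  are numbered from 1.
\<close>

definition box_prob :: "'a measure \<Rightarrow> (nat \<Rightarrow> 'a \<Rightarrow> nat) \<Rightarrow> nat \<Rightarrow> real" where
  "box_prob P X m = measure P {\<omega> \<in> space P. X 1 \<omega> = m}"

definition max_box_prob :: "'a measure \<Rightarrow> nat set \<Rightarrow> (nat \<Rightarrow> 'a \<Rightarrow> nat) \<Rightarrow> real" where
  "max_box_prob P B X = (SUP m\<in>B. box_prob P X m)"

text \<open>The \<open>s\<close>th moment of the random variable that takes the value \<open>box_prob P X m\<close> when box \<open>m\<close>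
  is selected. It depends only on the common law of the selections, so the first ball serves as the
  generic copy.\<close>

definition box_prob_moment :: "'a measure \<Rightarrow> (nat \<Rightarrow> 'a \<Rightarrow> nat) \<Rightarrow> nat \<Rightarrow> real" where
  "box_prob_moment P X s = prob_space.expectation P (\<lambda>\<omega>. box_prob P X (X 1 \<omega>) ^ s)"

definition ball_count :: "(nat \<Rightarrow> 'a \<Rightarrow> nat) \<Rightarrow> nat \<Rightarrow> nat \<Rightarrow> 'a \<Rightarrow> nat" where
  "ball_count X k m \<omega> = (\<Sum>j=1..<k. of_bool (X j \<omega> = m))"

text \<open>The set of boxes may be infinite, hence \<open>infsum\<close> instead of \<open>sum\<close>; at most one of the
  summands is nonzero.\<close>

definition ball_overflow :: "nat set \<Rightarrow> (nat \<Rightarrow> 'a \<Rightarrow> nat) \<Rightarrow> nat \<Rightarrow> nat \<Rightarrow> 'a \<Rightarrow> real" where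
  "ball_overflow B X r k \<omega> =
     (\<Sum>\<^sub>\<infinity>m\<in>B. of_bool (X k \<omega> = m) * of_bool (ball_count X k m \<omega> \<ge> r))"

definition overflow :: "nat set \<Rightarrow> (nat \<Rightarrow> 'a \<Rightarrow> nat) \<Rightarrow> nat \<Rightarrow> nat \<Rightarrow> 'a \<Rightarrow> real" where
  "overflow B X n r \<omega> = (\<Sum>k=1..n. ball_overflow B X r k \<omega>)"

lemma ball_overflow_eq:
  assumes "X k \<omega> \<in> B"
  shows "ball_overflow B X r k \<omega> = of_bool (ball_count X k (X k \<omega>) \<omega> \<ge> r)"
proof -
  have "ball_overflow B X r k \<omega> =
    (\<Sum>\<^sub>\<infinity>m\<in>{X k \<omega>}. of_bool (X k \<omega> = m) * of_bool (ball_count X k m \<omega> \<ge> r))"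
    unfolding ball_overflow_def using assms by (intro infsum_cong_neutral) auto
  then show ?thesis
    by simp
qed

end

theory Submission
  imports Defs
begin

text \<open>
  Write \<open>V\<close> for the overflow as a function of the iid selections \<open>x = (x\<^sub>1, \<dots>, x\<^sub>n)\<close>, let \<open>y\<close> be
  an independent copy of \<open>x\<close>, let \<open>\<Delta>\<^sub>j\<close> be the change of \<open>V x\<close> when \<open>x\<^sub>j\<close> is replaced by \<open>y\<^sub>j\<close>, and
  \<open>D\<^sub>j\<close> the change when the same replacement is made after coordinates \<open>1, \<dots>, j - 1\<close> have already
  been replaced. Exchangeability gives \<open>Cov (g (V x)) (V x) = 1/2 \<Sum>\<^sub>j E (g (V x) - g (V x - \<Delta>\<^sub>j)) D\<^sub>j\<close>.
  For \<open>g = exp (i u \<cdot>)\<close> and \<open>T = 1/2 \<Sum>\<^sub>j \<Delta>\<^sub>j D\<^sub>j\<close>, so that \<open>E T = Var V\<close>, this shows that the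
  characteristic function \<open>\<psi>\<close> of the centred overflow satisfies \<open>\<psi>' u = - u Var V \<psi> u\<close> up to an error
  controlled by \<open>Var T\<close> and \<open>\<Sum>\<^sub>j E |\<Delta>\<^sub>j|\<close>.

  Since \<open>V = \<Sum>\<^sub>m (N\<^sub>m - r)\<^sup>+\<close> with \<open>N\<^sub>m\<close> the number of balls in box \<open>m\<close>, a replacement matters only
  if it touches a box that holds at least \<open>r\<close> other balls. With \<open>\<mu> = n\<^sup>r\<^sup>+\<^sup>1 E p\<^sup>r\<close>, a Chernoff bound
  and the Efron--Stein inequality for \<open>T\<close> give \<open>Var T = O(\<mu>)\<close> and \<open>\<Sum>\<^sub>j E |\<Delta>\<^sub>j| = O(\<mu>)\<close>, while
  \<open>Var V \<ge> c \<mu>\<close>. Hence the characteristic function of the standardized overflow differs from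
  \<open>exp (- t\<^sup>2 / 2)\<close> by \<open>O(\<mu> powr (-1/2))\<close>, and Levy's continuity theorem applies.
\<close>

subsection \<open>Differences of functions of independent coordinates\<close>

lemma integrable_pmf_bounded:
  fixes f :: "'a \<Rightarrow> 'b::{banach, second_countable_topology}"
  assumes "\<And>x. norm (f x) \<le> b"
  shows "integrable (measure_pmf M) f"
  using assms by (intro measure_pmf.integrable_const_bound[where B = b]) auto

lemma expectation_pmf_abs_le:
  fixes f :: "'a \<Rightarrow> real"
  assumes "\<And>x. \<bar>f x\<bar> \<le> b"
  shows "\<bar>\<integral>x. f x \<partial>measure_pmf M\<bar> \<le> b"
proof -
  have "\<bar>\<integral>x. f x \<partial>measure_pmf M\<bar> \<le> (\<integral>x. \<bar>f x\<bar> \<partial>measure_pmf M)"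
    by (rule integral_abs_bound)
  also have "\<dots> \<le> (\<integral>x. b \<partial>measure_pmf M)"
    using assms by (intro integral_mono integrable_pmf_bounded[where b = b and 'b = real]) (auto intro: order_trans[OF abs_ge_zero])
  finally show ?thesis by simp
qed

text \<open>Fubini for bounded functions: adding \<open>b\<close> makes the integrand nonnegative,
  so the iterated nonnegative integral applies, and the constant is subtracted afterwards.\<close>

lemma expectation_pair_pmf:
  fixes f :: "'a \<times> 'b \<Rightarrow> real"
  assumes b: "\<And>z. \<bar>f z\<bar> \<le> b"
  shows "(\<integral>z. f z \<partial>measure_pmf (pair_pmf M N)) = (\<integral>x. \<integral>y. f (x, y) \<partial>measure_pmf N \<partial>measure_pmf M)"
proof -
  have pos: "0 \<le> f z + b" for z using b[of z] by linarith
  have bd: "\<bar>f z + b\<bar> \<le> 2 * b" for z using b[of z] by linarith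
  have int: "integrable (measure_pmf M') (\<lambda>x. f (h x) + b)" for M' :: "'c pmf" and h
    by (rule integrable_pmf_bounded[where b = "2 * b"]) (use bd in simp)
  have int0: "integrable (measure_pmf M') (\<lambda>x. f (h x))" for M' :: "'c pmf" and h
    by (rule integrable_pmf_bounded[where b = b]) (use b in simp)
  have inner: "(\<integral>y. f (x, y) + b \<partial>measure_pmf N) = (\<integral>y. f (x, y) \<partial>measure_pmf N) + b" for x
    by (subst Bochner_Integration.integral_add) (simp_all add: int0)
  have innerb: "\<bar>\<integral>y. f (x, y) \<partial>measure_pmf N\<bar> \<le> b" for x
    by (rule expectation_pmf_abs_le) (rule b)
  have int1: "integrable (measure_pmf M) (\<lambda>x. \<integral>y. f (x, y) \<partial>measure_pmf N)"
    by (rule integrable_pmf_bounded[where b = b]) (use innerb in simp)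
  have int2: "integrable (measure_pmf M) (\<lambda>x. \<integral>y. f (x, y) + b \<partial>measure_pmf N)"
    unfolding inner using int1 by simp
  have "ennreal (\<integral>z. f z + b \<partial>measure_pmf (pair_pmf M N))
      = (\<integral>\<^sup>+z. ennreal (f z + b) \<partial>measure_pmf (pair_pmf M N))"
    by (rule nn_integral_eq_integral[symmetric]) (auto simp: pos int)
  also have "\<dots> = (\<integral>\<^sup>+x. \<integral>\<^sup>+y. ennreal (f (x, y) + b) \<partial>measure_pmf N \<partial>measure_pmf M)"
    by (rule nn_integral_pair_pmf')
  also have "\<dots> = (\<integral>\<^sup>+x. ennreal (\<integral>y. f (x, y) + b \<partial>measure_pmf N) \<partial>measure_pmf M)"
    by (intro nn_integral_cong nn_integral_eq_integral) (auto simp: pos int)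
  also have "\<dots> = ennreal (\<integral>x. \<integral>y. f (x, y) + b \<partial>measure_pmf N \<partial>measure_pmf M)"
    by (rule nn_integral_eq_integral) (auto simp: pos int2 intro!: integral_nonneg_AE)
  finally have "(\<integral>z. f z + b \<partial>measure_pmf (pair_pmf M N))
      = (\<integral>x. \<integral>y. f (x, y) + b \<partial>measure_pmf N \<partial>measure_pmf M)"
    by (subst (asm) ennreal_inj) (auto simp: pos intro!: integral_nonneg_AE AE_pmfI)
  then show ?thesis
    using int0[of "pair_pmf M N" "\<lambda>z. z"] int1 unfolding inner by simp
qed

text \<open>Real and imaginary parts are treated separately, each by the real Fubini
  formula.\<close>

lemma expectation_pair_pmf_mult:
  fixes f :: "'b \<Rightarrow> real" and g :: "'a \<Rightarrow> complex"
  assumes f: "\<And>y. \<bar>f y\<bar> \<le> b" and g: "\<And>x. norm (g x) \<le> c"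
  shows "(\<integral>z. of_real (f (snd z)) * g (fst z) \<partial>measure_pmf (pair_pmf M N))
    = of_real (\<integral>y. f y \<partial>measure_pmf N) * (\<integral>x. g x \<partial>measure_pmf M)"
proof -
  have fg: "norm (of_real (f y) * g x) \<le> b * c" for x y
    unfolding norm_mult using f[of y] g[of x] by (intro mult_mono) (auto intro: order_trans[OF abs_ge_zero])
  have real: "(\<integral>z. f (snd z) * h (fst z) \<partial>measure_pmf (pair_pmf M N))
      = (\<integral>y. f y \<partial>measure_pmf N) * (\<integral>x. h x \<partial>measure_pmf M)"
    if h: "\<And>x. \<bar>h x\<bar> \<le> c" for h :: "'a \<Rightarrow> real"
  proof -
    have "\<bar>f (snd z) * h (fst z)\<bar> \<le> b * c" for z
      unfolding abs_mult using f[of "snd z"] h[of "fst z"]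
      by (intro mult_mono) (auto intro: order_trans[OF abs_ge_zero])
    then show ?thesis
      by (subst expectation_pair_pmf) simp_all
  qed
  have int: "integrable (measure_pmf (pair_pmf M N)) (\<lambda>z. of_real (f (snd z)) * g (fst z))"
    using fg by (rule integrable_pmf_bounded)
  have intg: "integrable (measure_pmf M) g"
    using g by (rule integrable_pmf_bounded)
  show ?thesis
  proof (rule complex_eqI)
    show "Re (\<integral>z. of_real (f (snd z)) * g (fst z) \<partial>measure_pmf (pair_pmf M N))
        = Re (of_real (\<integral>y. f y \<partial>measure_pmf N) * (\<integral>x. g x \<partial>measure_pmf M))"
      using real[of "\<lambda>x. Re (g x)"] order_trans[OF abs_Re_le_cmod g] int intg
      by (simp flip: integral_Re)
    show "Im (\<integral>z. of_real (f (snd z)) * g (fst z) \<partial>measure_pmf (pair_pmf M N))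
        = Im (of_real (\<integral>y. f y \<partial>measure_pmf N) * (\<integral>x. g x \<partial>measure_pmf M))"
      using real[of "\<lambda>x. Im (g x)"] order_trans[OF abs_Im_le_cmod g] int intg
      by (simp flip: integral_Im)
  qed
qed

lemma map_pmf_Pi_pmf:
  assumes "finite A"
  shows "map_pmf (\<lambda>z x. if x \<in> A then h x (z x) else d') (Pi_pmf A d p)
    = Pi_pmf A d' (\<lambda>x. map_pmf (h x) (p x))"
  using Pi_pmf_bind[OF assms, of d' p "\<lambda>x y. return_pmf (h x y)" d] assms
  by (simp add: map_pmf_def)

lemma Pi_pmf_outside:
  assumes "finite A" "z \<in> set_pmf (Pi_pmf A d p)" "i \<notin> A"
  shows "z i = d"
  using assms set_Pi_pmf_subset by fastforce

section \<open>Independent copies and their exchange\<close>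

definition iid :: "'b pmf \<Rightarrow> 'b \<Rightarrow> nat \<Rightarrow> (nat \<Rightarrow> 'b) pmf" where
  "iid q d n = Pi_pmf {1..n} d (\<lambda>_. q)"

abbreviation iid2 :: "'b pmf \<Rightarrow> 'b \<Rightarrow> nat \<Rightarrow> (nat \<Rightarrow> 'b \<times> 'b) pmf" where
  "iid2 q d n \<equiv> iid (pair_pmf q q) (d, d) n"

text \<open>Each coordinate of \<open>z\<close> holds an original and its independent copy:
  \<open>mix {} z\<close> is the sample \<open>x\<close> of the overview, \<open>mix UNIV z\<close>
  its copy \<open>y\<close>, and \<open>mix S z\<close> a hybrid that is resampled exactly on
  \<open>S\<close>.\<close>

definition mix :: "nat set \<Rightarrow> (nat \<Rightarrow> 'b \<times> 'b) \<Rightarrow> nat \<Rightarrow> 'b" where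
  "mix S z i = (if i \<in> S then snd (z i) else fst (z i))"

definition swap_on :: "nat set \<Rightarrow> (nat \<Rightarrow> 'b \<times> 'b) \<Rightarrow> nat \<Rightarrow> 'b \<times> 'b" where
  "swap_on S z i = (if i \<in> S then prod.swap (z i) else z i)"

text \<open>Two exchanges of the same coordinate cancel, which leaves the symmetric difference.
  Every symmetry argument below reduces to this computation with index sets.\<close>

lemma mix_swap_on: "mix S (swap_on U z) = mix ((S - U) \<union> (U - S)) z"
  by (auto simp: mix_def swap_on_def fun_eq_iff)

lemma iid_outside: "z \<in> set_pmf (iid q d n) \<Longrightarrow> i \<notin> {1..n} \<Longrightarrow> z i = d"
  unfolding iid_def by (rule Pi_pmf_outside) auto

lemma map_pmf_mix: "map_pmf (mix S) (iid2 q d n) = iid q d n"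
proof -
  \<comment> \<open>On the support, coordinates outside \<open>{1..n}\<close> are
    \<open>(d, d)\<close>, so \<open>mix\<close> agrees there with the default
    \<open>d\<close>.\<close>
  have "map_pmf (mix S) (iid2 q d n)
      = map_pmf (\<lambda>z i. if i \<in> {1..n} then (if i \<in> S then snd else fst) (z i) else d) (iid2 q d n)"
    by (rule map_pmf_cong[OF refl]) (use iid_outside in \<open>fastforce simp: mix_def\<close>)
  also have "\<dots> = iid q d n"
    unfolding iid_def
    by (subst map_pmf_Pi_pmf) (auto intro!: Pi_pmf_cong simp: map_fst_pair_pmf map_snd_pair_pmf)
  finally show ?thesis .
qed

lemma map_pmf_swap_on: "map_pmf (swap_on S) (iid2 q d n) = iid2 q d n"
proof -
  have swap: "map_pmf prod.swap (pair_pmf q q) = pair_pmf q q"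
    by (subst (2) pair_commute_pmf) (auto intro!: map_pmf_cong)
  have "map_pmf (swap_on S) (iid2 q d n)
      = map_pmf (\<lambda>z i. if i \<in> {1..n} then (if i \<in> S then prod.swap else id) (z i) else (d, d)) (iid2 q d n)"
    by (rule map_pmf_cong[OF refl]) (use iid_outside in \<open>fastforce simp: swap_on_def\<close>)
  also have "\<dots> = iid2 q d n"
    unfolding iid_def
    by (subst map_pmf_Pi_pmf) (auto intro!: Pi_pmf_cong simp: swap)
  finally show ?thesis .
qed

lemma expectation_mix:
  fixes h :: "_ \<Rightarrow> 'c::{banach, second_countable_topology}"
  shows "(\<integral>z. h (mix S z) \<partial>measure_pmf (iid2 q d n)) = (\<integral>x. h x \<partial>measure_pmf (iid q d n))"
  by (subst (2) map_pmf_mix[symmetric, of _ _ _ S]) simp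

lemma expectation_swap_on:
  fixes h :: "_ \<Rightarrow> 'c::{banach, second_countable_topology}"
  shows "(\<integral>z. h (swap_on S z) \<partial>measure_pmf (iid2 q d n)) = (\<integral>z. h z \<partial>measure_pmf (iid2 q d n))"
  by (subst (2) map_pmf_swap_on[symmetric, of _ _ _ S]) simp

text \<open>Point masses are compared: separating the two copies is injective, and each point mass
  of \<open>iid2\<close> is a product over coordinates that splits into one factor per copy.\<close>

lemma map_pmf_mix_pair:
  "map_pmf (\<lambda>z. (mix {} z, mix UNIV z)) (iid2 q d n) = pair_pmf (iid q d n) (iid q d n)"
proof (rule pmf_eqI)
  fix xy :: "(nat \<Rightarrow> 'a) \<times> (nat \<Rightarrow> 'a)"
  obtain x y where xy: "xy = (x, y)" by force
  define z where "z i = (x i, y i)" for i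
  have z: "xy = (mix {} z, mix UNIV z)"
    by (auto simp: xy z_def mix_def)
  have inj: "inj (\<lambda>z :: nat \<Rightarrow> 'a \<times> 'a. (mix {} z, mix UNIV z))"
    by (rule injI) (auto simp: mix_def fun_eq_iff prod_eq_iff)
  have "pmf (map_pmf (\<lambda>z. (mix {} z, mix UNIV z)) (iid2 q d n)) xy = pmf (iid2 q d n) z"
    unfolding z by (rule pmf_map_inj'[OF inj])
  also have "\<dots> = pmf (iid q d n) x * pmf (iid q d n) y"
    by (auto simp: iid_def pmf_Pi z_def pmf_pair prod.distrib)
  finally show "pmf (map_pmf (\<lambda>z. (mix {} z, mix UNIV z)) (iid2 q d n)) xy
      = pmf (pair_pmf (iid q d n) (iid q d n)) xy"
    by (simp add: xy pmf_pair)
qed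

section \<open>Difference operators, covariance formula and Efron-Stein inequality\<close>

definition dif :: "((nat \<Rightarrow> 'b) \<Rightarrow> 'c::ab_group_add) \<Rightarrow> nat \<Rightarrow> (nat \<Rightarrow> 'b \<times> 'b) \<Rightarrow> 'c" where
  "dif f j z = f (mix {} z) - f (mix {j} z)"

text \<open>For \<open>f = V\<close>, \<open>dif f j\<close> is \<open>\<Delta>\<^sub>j\<close> and
  \<open>step f j\<close> is \<open>D\<^sub>j\<close> of the overview. The increments
  \<open>step f j\<close> telescope along the path from the sample to its copy.\<close>

definition step :: "((nat \<Rightarrow> 'b) \<Rightarrow> 'c::ab_group_add) \<Rightarrow> nat \<Rightarrow> (nat \<Rightarrow> 'b \<times> 'b) \<Rightarrow> 'c" where
  "step f j z = f (mix {1..<j} z) - f (mix {1..j} z)"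

lemma sum_step: "(\<Sum>j=1..n. step f j z) = f (mix {} z) - f (mix {1..n} z)"
proof (induction n)
  case (Suc n)
  then show ?case
    by (simp add: step_def atLeastLessThanSuc_atLeastAtMost)
qed simp

lemma dif_bound: "(\<And>x. norm (f x) \<le> b) \<Longrightarrow> norm (dif f j z) \<le> 2 * b"
  unfolding dif_def mult_2 by (rule order_trans[OF norm_triangle_ineq4]) (intro add_mono)

lemma step_bound: "(\<And>x. norm (f x) \<le> b) \<Longrightarrow> norm (step f j z) \<le> 2 * b"
  unfolding step_def mult_2 by (rule order_trans[OF norm_triangle_ineq4]) (intro add_mono)

lemma norm_mult_bounded:
  fixes x y :: "'a::real_normed_algebra"
  shows "norm x \<le> b \<Longrightarrow> norm y \<le> c \<Longrightarrow> norm (x * y) \<le> b * c"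
  by (rule order_trans[OF norm_mult_ineq]) (auto intro!: mult_mono intro: order_trans[OF norm_ge_zero])

text \<open>Exchanging the two copies of coordinate \<open>j\<close> reverses the sign of \<open>step f j\<close>; this turns
  the telescoping sum for \<open>f x - f y\<close>, with \<open>y\<close> an independent copy of \<open>x\<close>, into a formula that
  involves only differences.\<close>

lemma covariance_formula:
  fixes f :: "(nat \<Rightarrow> 'b) \<Rightarrow> real" and g :: "(nat \<Rightarrow> 'b) \<Rightarrow> complex"
  assumes f: "\<And>x. \<bar>f x\<bar> \<le> b" and g: "\<And>x. norm (g x) \<le> c"
  shows "(\<integral>x. of_real (f x) * g x \<partial>measure_pmf (iid q d n))
      - of_real (\<integral>x. f x \<partial>measure_pmf (iid q d n)) * (\<integral>x. g x \<partial>measure_pmf (iid q d n))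
    = (\<Sum>j=1..n. \<integral>z. of_real (step f j z) * dif g j z \<partial>measure_pmf (iid2 q d n)) / 2"
proof -
  let ?P = "iid q d n" and ?Q = "iid2 q d n"
  have f': "norm (of_real (f x) :: complex) \<le> b" for x using f by simp
  have sb: "norm (of_real (step f j z) :: complex) \<le> 2 * b" for j z
    using step_bound[of f b] f by simp
  have int: "integrable (measure_pmf M) (\<lambda>z. of_real (f (u z)) * g (v z))" for M :: "'z pmf" and u v
    by (rule integrable_pmf_bounded) (rule norm_mult_bounded[OF f' g])
  have ints: "integrable (measure_pmf ?Q) (\<lambda>z. of_real (step f j z) * g (v z))" for v j
    by (rule integrable_pmf_bounded) (rule norm_mult_bounded[OF sb g])
  have "of_real (\<integral>x. f x \<partial>measure_pmf ?P) * (\<integral>x. g x \<partial>measure_pmf ?P)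
      = (\<integral>z. of_real (f (snd z)) * g (fst z) \<partial>measure_pmf (pair_pmf ?P ?P))"
    by (rule expectation_pair_pmf_mult[symmetric, OF f g])
  also have "\<dots> = (\<integral>z. of_real (f (mix UNIV z)) * g (mix {} z) \<partial>measure_pmf ?Q)"
    by (subst map_pmf_mix_pair[symmetric]) simp
  \<comment> \<open>The two copies agree outside \<open>{1..n}\<close> almost surely, so finitely
    many replacements lead from one to the other and \<open>sum_step\<close> applies.\<close>
  also have "\<dots> = (\<integral>z. of_real (f (mix {1..n} z)) * g (mix {} z) \<partial>measure_pmf ?Q)"
  proof (intro integral_cong_AE AE_pmfI)
    fix z assume "z \<in> set_pmf ?Q"
    then have "mix UNIV z = mix {1..n} z"
      using iid_outside by (fastforce simp: mix_def)
    then show "of_real (f (mix UNIV z)) * g (mix {} z) = of_real (f (mix {1..n} z)) * g (mix {} z)"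
      by simp
  qed auto
  finally have "(\<integral>x. of_real (f x) * g x \<partial>measure_pmf ?P)
      - of_real (\<integral>x. f x \<partial>measure_pmf ?P) * (\<integral>x. g x \<partial>measure_pmf ?P)
    = (\<integral>z. of_real (f (mix {} z)) * g (mix {} z) \<partial>measure_pmf ?Q)
      - (\<integral>z. of_real (f (mix {1..n} z)) * g (mix {} z) \<partial>measure_pmf ?Q)"
    using expectation_mix[where h = "\<lambda>x. of_real (f x) * g x" and S = "{}" and q = q and d = d and n = n] by simp
  also have "\<dots> = (\<integral>z. of_real (f (mix {} z) - f (mix {1..n} z)) * g (mix {} z) \<partial>measure_pmf ?Q)"
    by (simp add: int ring_distribs flip: Bochner_Integration.integral_diff)
  also have "\<dots> = (\<integral>z. (\<Sum>j=1..n. of_real (step f j z) * g (mix {} z)) \<partial>measure_pmf ?Q)"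
    by (simp only: sum_step flip: sum_distrib_right of_real_sum)
  also have "\<dots> = (\<Sum>j=1..n. \<integral>z. of_real (step f j z) * g (mix {} z) \<partial>measure_pmf ?Q)"
    by (intro Bochner_Integration.integral_sum ints)
  also have "\<dots> = (\<Sum>j=1..n. \<integral>z. of_real (step f j z) * dif g j z / 2 \<partial>measure_pmf ?Q)"
  proof (rule sum.cong[OF refl])
    fix j assume j: "j \<in> {1..n}"
    have sw: "step f j (swap_on {j} z) = - step f j z" "mix {} (swap_on {j} z) = mix {j} z" for z
    proof -
      have "({1..<j} - {j}) \<union> ({j} - {1..<j}) = {1..j}" "({1..j} - {j}) \<union> ({j} - {1..j}) = {1..<j}"
        using j by auto
      then show "step f j (swap_on {j} z) = - step f j z" "mix {} (swap_on {j} z) = mix {j} z"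
        by (simp_all add: step_def mix_swap_on)
    qed
    have "(\<integral>z. of_real (step f j z) * g (mix {} z) \<partial>measure_pmf ?Q)
        = (\<integral>z. of_real (- step f j z) * g (mix {j} z) \<partial>measure_pmf ?Q)"
      using expectation_swap_on[where h = "\<lambda>z. of_real (step f j z) * g (mix {} z)" and S = "{j}"
        and q = q and d = d and n = n]
      by (simp add: sw)
    then have "(\<integral>z. of_real (step f j z) * g (mix {} z) \<partial>measure_pmf ?Q)
      = ((\<integral>z. of_real (step f j z) * g (mix {} z) \<partial>measure_pmf ?Q)
        - (\<integral>z. of_real (step f j z) * g (mix {j} z) \<partial>measure_pmf ?Q)) / 2"
      by simp
    also have "\<dots> = (\<integral>z. of_real (step f j z) * dif g j z / 2 \<partial>measure_pmf ?Q)"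
      by (simp add: ints dif_def ring_distribs flip: Bochner_Integration.integral_diff)
    finally show "(\<integral>z. of_real (step f j z) * g (mix {} z) \<partial>measure_pmf ?Q)
        = (\<integral>z. of_real (step f j z) * dif g j z / 2 \<partial>measure_pmf ?Q)" .
  qed
  finally show ?thesis
    by (simp add: sum_divide_distrib)
qed

lemma variance_formula:
  fixes f :: "(nat \<Rightarrow> 'b) \<Rightarrow> real"
  assumes f: "\<And>x. \<bar>f x\<bar> \<le> b"
  shows "measure_pmf.variance (iid q d n) f
    = (\<Sum>j=1..n. \<integral>z. step f j z * dif f j z \<partial>measure_pmf (iid2 q d n)) / 2"
proof -
  let ?P = "iid q d n" and ?Q = "iid2 q d n"
  have dif: "dif (\<lambda>x. of_real (f x)) j z = complex_of_real (dif f j z)" for j z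
    by (simp add: dif_def)
  have "complex_of_real ((\<integral>x. f x * f x \<partial>measure_pmf ?P)
      - (\<integral>x. f x \<partial>measure_pmf ?P) * (\<integral>x. f x \<partial>measure_pmf ?P))
    = complex_of_real ((\<Sum>j=1..n. \<integral>z. step f j z * dif f j z \<partial>measure_pmf ?Q) / 2)"
    using covariance_formula[of f b "\<lambda>x. of_real (f x)" b q d n] f
    by (simp add: dif flip: of_real_mult)
  then have "(\<integral>x. f x * f x \<partial>measure_pmf ?P)
      - (\<integral>x. f x \<partial>measure_pmf ?P) * (\<integral>x. f x \<partial>measure_pmf ?P)
    = (\<Sum>j=1..n. \<integral>z. step f j z * dif f j z \<partial>measure_pmf ?Q) / 2"
    by (subst (asm) of_real_eq_iff)
  moreover have "integrable (measure_pmf ?P) f"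
    by (rule integrable_pmf_bounded[where b = b]) (use f in simp)
  moreover have "integrable (measure_pmf ?P) (\<lambda>x. (f x)\<^sup>2)"
    unfolding power2_eq_square
    by (rule integrable_pmf_bounded, rule norm_mult_bounded) (use f in simp_all)
  ultimately show ?thesis
    by (subst measure_pmf.variance_eq) (simp_all add: power2_eq_square)
qed

text \<open>In the variance formula the product of \<open>step\<close> and \<open>dif\<close> is at
  most half the sum of their squares. Exchanging the copies of the coordinates before
  \<open>j\<close> turns \<open>dif f j\<close> into \<open>step f j\<close>, so both have the same
  second moment.\<close>

lemma efron_stein:
  fixes f :: "(nat \<Rightarrow> 'b) \<Rightarrow> real"
  assumes f: "\<And>x. \<bar>f x\<bar> \<le> b"
  shows "measure_pmf.variance (iid q d n) f
    \<le> (\<Sum>j=1..n. \<integral>z. (dif f j z)\<^sup>2 \<partial>measure_pmf (iid2 q d n)) / 2"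
proof -
  let ?Q = "iid2 q d n"
  have db: "norm (dif f j z) \<le> 2 * b" and sb: "norm (step f j z) \<le> 2 * b" for j z
    using dif_bound[of f b] step_bound[of f b] f by auto
  have i1: "integrable (measure_pmf ?Q) (\<lambda>z. step f j z * dif f j z)"
    and i2: "integrable (measure_pmf ?Q) (\<lambda>z. (step f j z)\<^sup>2)"
    and i3: "integrable (measure_pmf ?Q) (\<lambda>z. (dif f j z)\<^sup>2)" for j
    unfolding power2_eq_square
    by (rule integrable_pmf_bounded, rule norm_mult_bounded[OF sb db] norm_mult_bounded[OF sb sb]
        norm_mult_bounded[OF db db])+
  have "(\<integral>z. step f j z * dif f j z \<partial>measure_pmf ?Q) \<le> (\<integral>z. (dif f j z)\<^sup>2 \<partial>measure_pmf ?Q)"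
    if j: "j \<in> {1..n}" for j
  proof -
    have "dif f j (swap_on {1..<j} z) = step f j z" for z
    proof -
      have "({j} - {1..<j}) \<union> ({1..<j} - {j}) = {1..j}" using j by auto
      then show ?thesis by (simp add: step_def dif_def mix_swap_on)
    qed
    then have eq: "(\<integral>z. (step f j z)\<^sup>2 \<partial>measure_pmf ?Q) = (\<integral>z. (dif f j z)\<^sup>2 \<partial>measure_pmf ?Q)"
      using expectation_swap_on[where h = "\<lambda>z. (dif f j z)\<^sup>2" and S = "{1..<j}" and q = q and d = d and n = n]
      by simp
    have am: "x * y \<le> (x\<^sup>2 + y\<^sup>2) / 2" for x y :: real
      using sum_squares_bound[of x y] by simp
    have "(\<integral>z. step f j z * dif f j z \<partial>measure_pmf ?Q)
        \<le> (\<integral>z. ((step f j z)\<^sup>2 + (dif f j z)\<^sup>2) / 2 \<partial>measure_pmf ?Q)"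
      by (rule integral_mono, rule i1, simp add: i2 i3, rule am)
    also have "\<dots> = (\<integral>z. (dif f j z)\<^sup>2 \<partial>measure_pmf ?Q)"
      by (simp add: i2 i3 eq)
    finally show ?thesis .
  qed
  then show ?thesis
    unfolding variance_formula[OF f] by (intro divide_right_mono sum_mono) auto
qed

subsection \<open>Approximate differential equation for the characteristic function\<close>

lemma norm_expectation_pmf_le:
  fixes f :: "'a \<Rightarrow> 'b::{banach, second_countable_topology}"
  assumes h: "integrable (measure_pmf M) h" and le: "\<And>x. norm (f x) \<le> h x"
  shows "norm (\<integral>x. f x \<partial>measure_pmf M) \<le> (\<integral>x. h x \<partial>measure_pmf M)"
proof -
  have "integrable (measure_pmf M) (\<lambda>x. norm (f x))"
    using h by (rule Bochner_Integration.integrable_bound) (auto intro!: order_trans[OF le abs_ge_self])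
  then have "(\<integral>x. norm (f x) \<partial>measure_pmf M) \<le> (\<integral>x. h x \<partial>measure_pmf M)"
    using h le by (rule integral_mono)
  then show ?thesis
    using integral_norm_bound order_trans by blast
qed

lemma iexp_taylor1: "norm (iexp x - 1 - \<i> * x) \<le> x\<^sup>2 / 2"
  using iexp_approx1[of x 1] by (simp add: algebra_simps power2_eq_square)

lemma onorm_scaleR_vector: "onorm (\<lambda>h. h *\<^sub>R D) \<le> norm (D :: 'a::real_normed_vector)"
  by (rule onorm_le) (simp add: mult.commute)

text \<open>Differentiation under the integral: since \<open>w\<close> is bounded, the second-order
  Taylor remainder of the exponential is at most \<open>b\<^sup>2 * (y - s)\<^sup>2 / 2\<close>
  uniformly in \<open>x\<close>.\<close>

lemma char_centered_derivative:
  fixes w :: "'a \<Rightarrow> real"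
  assumes w: "\<And>x. \<bar>w x\<bar> \<le> b"
  shows "((\<lambda>s. \<integral>x. iexp (s * w x) \<partial>measure_pmf M)
    has_vector_derivative (\<integral>x. \<i> * (of_real (w x) * iexp (s * w x)) \<partial>measure_pmf M)) (at s)"
proof -
  let ?E = "\<lambda>g. (\<integral>x. g x \<partial>measure_pmf M) :: complex"
  have b: "0 \<le> b" using w[of undefined] by linarith
  have i1: "integrable (measure_pmf M) (\<lambda>x. iexp (s * w x))" for s
    by (rule integrable_pmf_bounded[where b = 1]) simp
  have i2: "integrable (measure_pmf M) (\<lambda>x. \<i> * (of_real (w x) * iexp (s * w x)))"
    by (rule integrable_pmf_bounded[where b = b]) (use w in \<open>simp add: norm_mult\<close>)
  show ?thesis
    unfolding has_vector_derivative_def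
  proof (rule has_derivativeI_sandwich[where e = 1 and H = "\<lambda>y. b\<^sup>2 * \<bar>y - s\<bar> / 2"])
    show "bounded_linear (\<lambda>h. h *\<^sub>R ?E (\<lambda>x. \<i> * (of_real (w x) * iexp (s * w x))))"
      by (rule bounded_linear_scaleR_left)
    have "((\<lambda>y. b\<^sup>2 * \<bar>y - s\<bar> / 2) \<longlongrightarrow> b\<^sup>2 * \<bar>s - s\<bar> / 2) (at s)"
      by (intro tendsto_intros) simp
    then show "((\<lambda>y. b\<^sup>2 * \<bar>y - s\<bar> / 2) \<longlongrightarrow> 0) (at s)"
      by simp
    fix y :: real assume y: "y \<noteq> s"
    have pw: "norm (iexp (y * w x) - iexp (s * w x) - of_real (y - s) * (\<i> * (of_real (w x) * iexp (s * w x))))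
        \<le> b\<^sup>2 * (y - s)\<^sup>2 / 2" for x
    proof -
      have "iexp (y * w x) = iexp (s * w x) * iexp ((y - s) * w x)"
        by (simp add: algebra_simps flip: exp_add)
      then have "iexp (y * w x) - iexp (s * w x) - of_real (y - s) * (\<i> * (of_real (w x) * iexp (s * w x)))
          = iexp (s * w x) * (iexp ((y - s) * w x) - 1 - \<i> * of_real ((y - s) * w x))"
        by (simp add: algebra_simps)
      then have "norm (iexp (y * w x) - iexp (s * w x) - of_real (y - s) * (\<i> * (of_real (w x) * iexp (s * w x))))
          \<le> ((y - s) * w x)\<^sup>2 / 2"
        using iexp_taylor1[of "(y - s) * w x"] by (simp add: norm_mult)
      also have "\<dots> \<le> b\<^sup>2 * (y - s)\<^sup>2 / 2"
        using power_mono[OF w[of x], of 2] by (simp add: power_mult_distrib mult.commute mult_left_mono mult_right_mono)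
      finally show ?thesis .
    qed
    have "norm (?E (\<lambda>x. iexp (y * w x)) - ?E (\<lambda>x. iexp (s * w x))
        - (y - s) *\<^sub>R ?E (\<lambda>x. \<i> * (of_real (w x) * iexp (s * w x))))
      = norm (?E (\<lambda>x. iexp (y * w x) - iexp (s * w x) - of_real (y - s) * (\<i> * (of_real (w x) * iexp (s * w x)))))"
    proof -
      have "?E (\<lambda>x. iexp (y * w x) - iexp (s * w x) - of_real (y - s) * (\<i> * (of_real (w x) * iexp (s * w x))))
        = ?E (\<lambda>x. iexp (y * w x)) - ?E (\<lambda>x. iexp (s * w x))
        - ?E (\<lambda>x. of_real (y - s) * (\<i> * (of_real (w x) * iexp (s * w x))))"
        by (simp only: Bochner_Integration.integral_diff[OF Bochner_Integration.integrable_diff[OF i1 i1]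
              integrable_mult_right[OF i2]] Bochner_Integration.integral_diff[OF i1 i1])
      then show ?thesis
        by (simp only: integral_mult_right_zero scaleR_conv_of_real)
    qed
    also have "\<dots> \<le> (\<integral>x. b\<^sup>2 * (y - s)\<^sup>2 / 2 \<partial>measure_pmf M)"
      by (rule norm_expectation_pmf_le) (simp, rule pw)
    finally have "norm (?E (\<lambda>x. iexp (y * w x)) - ?E (\<lambda>x. iexp (s * w x))
        - (y - s) *\<^sub>R ?E (\<lambda>x. \<i> * (of_real (w x) * iexp (s * w x)))) \<le> b\<^sup>2 * (y - s)\<^sup>2 / 2"
      by simp
    then show "norm (?E (\<lambda>x. iexp (y * w x)) - ?E (\<lambda>x. iexp (s * w x))
        - (y - s) *\<^sub>R ?E (\<lambda>x. \<i> * (of_real (w x) * iexp (s * w x)))) / norm (y - s) \<le> b\<^sup>2 * \<bar>y - s\<bar> / 2"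
      using y by (simp add: divide_simps power2_eq_square mult.assoc)
  qed auto
qed

text \<open>The integrating factor \<open>exp (s\<^sup>2 * v / 2)\<close> turns the perturbed
  equation into a bound on the derivative of a single function \<open>h\<close>, to which the mean
  value inequality applies.\<close>

lemma gaussian_of_approximate_ode:
  fixes \<psi> :: "real \<Rightarrow> complex"
  assumes deriv: "\<And>s. (\<psi> has_vector_derivative \<psi>' s) (at s)" and one: "\<psi> 0 = 1"
    and v: "0 \<le> v" and nonneg: "0 \<le> \<tau>" "0 \<le> \<beta>"
    and bound: "\<And>s. norm (\<psi>' s + of_real (s * v) * \<psi> s) \<le> \<bar>s\<bar> * \<tau> + s\<^sup>2 * \<beta>"
  shows "norm (\<psi> u - of_real (exp (- (u\<^sup>2 * v / 2)))) \<le> u\<^sup>2 * \<tau> + \<bar>u\<bar> ^ 3 * \<beta>"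
proof -
  define h where "h s = exp (s\<^sup>2 * v / 2) *\<^sub>R \<psi> s" for s
  define h' where "h' s = exp (s\<^sup>2 * v / 2) *\<^sub>R (\<psi>' s + of_real (s * v) * \<psi> s)" for s
  \<comment> \<open>\<open>K\<close> bounds \<open>h'\<close> on the symmetric interval, which
    handles both signs of \<open>u\<close>. Its exponential is the one at the endpoint and cancels
    exactly when the integrating factor is removed.\<close>
  define K where "K = exp (u\<^sup>2 * v / 2) * (\<bar>u\<bar> * \<tau> + u\<^sup>2 * \<beta>)"
  have h: "(h has_vector_derivative h' s) (at s within A)" for s A
  proof -
    have "((\<lambda>s. exp (s\<^sup>2 * v / 2)) has_real_derivative exp (s\<^sup>2 * v / 2) * (s * v)) (at s)"
      by (auto intro!: derivative_eq_intros)
    from has_vector_derivative_scaleR[OF this deriv]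
    have "(h has_vector_derivative h' s) (at s)"
      unfolding h_def h'_def by (rule has_vector_derivative_eq_rhs)
        (simp add: scaleR_conv_of_real algebra_simps)
    then show ?thesis by (rule has_vector_derivative_at_within)
  qed
  have "norm (h u - h 0) \<le> K * norm (u - 0)"
  proof (rule differentiable_bound[where S = "{- \<bar>u\<bar>..\<bar>u\<bar>}" and f' = "\<lambda>s x. x *\<^sub>R h' s"])
    fix s assume s: "s \<in> {- \<bar>u\<bar>..\<bar>u\<bar>}"
    show "(h has_derivative (\<lambda>x. x *\<^sub>R h' s)) (at s within {- \<bar>u\<bar>..\<bar>u\<bar>})"
      using h[of s] by (simp add: has_vector_derivative_def)
    have su: "\<bar>s\<bar> \<le> \<bar>u\<bar>" "s\<^sup>2 \<le> u\<^sup>2"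
      using s by (auto simp: abs_le_square_iff[symmetric])
    have "norm (h' s) \<le> exp (s\<^sup>2 * v / 2) * (\<bar>s\<bar> * \<tau> + s\<^sup>2 * \<beta>)"
      unfolding h'_def using bound[of s] by simp
    also have "\<dots> \<le> K"
      unfolding K_def using su v nonneg
      by (intro mult_mono add_mono) (auto intro: mult_right_mono)
    finally show "onorm (\<lambda>x. x *\<^sub>R h' s) \<le> K"
      using onorm_scaleR_vector[of "h' s"] by linarith
  qed auto
  then have K: "norm (h u - 1) \<le> K * \<bar>u\<bar>"
    by (simp add: h_def one)
  have "\<psi> u - of_real (exp (- (u\<^sup>2 * v / 2))) = exp (- (u\<^sup>2 * v / 2)) *\<^sub>R (h u - 1)"
    by (simp add: h_def scaleR_diff_right of_real_def flip: exp_add)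
  then have "norm (\<psi> u - of_real (exp (- (u\<^sup>2 * v / 2)))) \<le> exp (- (u\<^sup>2 * v / 2)) * (K * \<bar>u\<bar>)"
    using K by simp
  also have "\<dots> = u\<^sup>2 * \<tau> + \<bar>u\<bar> ^ 3 * \<beta>"
  proof -
    have "exp (- c) * (exp c * (a * \<tau> + a\<^sup>2 * \<beta>) * a) = a\<^sup>2 * \<tau> + a ^ 3 * \<beta>" for a c :: real
      by (simp add: exp_minus field_simps power2_eq_square power3_eq_cube)
    from this[of "u\<^sup>2 * v / 2" "\<bar>u\<bar>"] show ?thesis
      by (simp add: K_def)
  qed
  finally show ?thesis .
qed

text \<open>This is \<open>T\<close> of the overview, a random quantity with mean equal to the
  variance of \<open>f\<close>.\<close>

definition stein :: "((nat \<Rightarrow> 'b) \<Rightarrow> real) \<Rightarrow> nat \<Rightarrow> (nat \<Rightarrow> 'b \<times> 'b) \<Rightarrow> real" where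
  "stein f n z = (\<Sum>j=1..n. step f j z * dif f j z) / 2"

lemma step_dif_bound:
  fixes f :: "(nat \<Rightarrow> 'b) \<Rightarrow> real"
  assumes "\<And>x. \<bar>f x\<bar> \<le> b"
  shows "\<bar>step f j z * dif f j z\<bar> \<le> (2 * b) * (2 * b)"
  using norm_mult_bounded[OF step_bound[of f b] dif_bound[of f b], of j z j z] assms by simp

lemma stein_bound:
  fixes f :: "(nat \<Rightarrow> 'b) \<Rightarrow> real"
  assumes "\<And>x. \<bar>f x\<bar> \<le> b"
  shows "\<bar>stein f n z\<bar> \<le> n * ((2 * b) * (2 * b))"
proof -
  have "\<bar>\<Sum>j=1..n. step f j z * dif f j z\<bar> \<le> (\<Sum>j=1..n. (2 * b) * (2 * b))"
    by (rule order_trans[OF sum_abs], rule sum_mono, rule step_dif_bound, rule assms)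
  moreover have "0 \<le> real n * ((2 * b) * (2 * b))"
    by simp
  ultimately show ?thesis
    unfolding stein_def by simp
qed

lemma expectation_stein:
  assumes f: "\<And>x. \<bar>f x\<bar> \<le> b"
  shows "(\<integral>z. stein f n z \<partial>measure_pmf (iid2 q d n)) = measure_pmf.variance (iid q d n) f"
proof -
  have "integrable (measure_pmf (iid2 q d n)) (\<lambda>z. step f j z * dif f j z)" for j
    by (rule integrable_pmf_bounded) (use step_dif_bound[OF f] in simp)
  then show ?thesis
    unfolding variance_formula[OF f] stein_def by simp
qed

text \<open>The derivative of the characteristic function is \<open>\<i>\<close> times a covariance.
  By the covariance formula and a first-order expansion of the exponential it is, up to the error
  from \<open>\<beta>\<close>, an expectation involving \<open>stein f n\<close>; replacing
  \<open>stein f n\<close> by its mean \<open>v\<close> costs \<open>\<tau>\<close>.\<close>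

lemma stein_char_bound:
  fixes f :: "(nat \<Rightarrow> 'b) \<Rightarrow> real" and q :: "'b pmf" and d :: 'b and n :: nat
  assumes f: "\<And>x. \<bar>f x\<bar> \<le> b"
  defines "m \<equiv> \<integral>x. f x \<partial>measure_pmf (iid q d n)"
    and "v \<equiv> measure_pmf.variance (iid q d n) f"
  assumes \<tau>: "(\<integral>z. \<bar>stein f n z - v\<bar> \<partial>measure_pmf (iid2 q d n)) \<le> \<tau>"
    and \<beta>: "(\<Sum>j=1..n. \<integral>z. \<bar>step f j z\<bar> * (dif f j z)\<^sup>2 \<partial>measure_pmf (iid2 q d n)) \<le> \<beta>"
  shows "norm ((\<integral>x. iexp (u * (f x - m)) \<partial>measure_pmf (iid q d n)) - of_real (exp (- (u\<^sup>2 * v / 2))))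
    \<le> u\<^sup>2 * \<tau> + \<bar>u\<bar> ^ 3 * (\<beta> / 4)"
proof (rule gaussian_of_approximate_ode)
  let ?P = "iid q d n" and ?Q = "iid2 q d n"
  have m: "\<bar>m\<bar> \<le> b"
    unfolding m_def by (rule expectation_pmf_abs_le) (rule f)
  have w: "\<bar>f x - m\<bar> \<le> 2 * b" for x
    using f[of x] m by linarith
  show "((\<lambda>u. \<integral>x. iexp (u * (f x - m)) \<partial>measure_pmf ?P) has_vector_derivative
      (\<integral>x. \<i> * (of_real (f x - m) * iexp (s * (f x - m))) \<partial>measure_pmf ?P)) (at s)" for s
    by (rule char_centered_derivative[OF w])
  show "0 \<le> v"
    unfolding v_def by (simp add: integral_nonneg_AE)
  show "0 \<le> \<tau>"
    by (rule order_trans[OF _ \<tau>]) (simp add: integral_nonneg_AE)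
  show "0 \<le> \<beta> / 4"
    using order_trans[OF _ \<beta>, of 0] by (simp add: sum_nonneg integral_nonneg_AE)
  fix s :: real
  define g where "g x = iexp (s * (f x - m))" for x
  have g: "norm (g x) \<le> 1" for x by (simp add: g_def)
  have ig: "integrable (measure_pmf M) (\<lambda>z. g (h z))" for M :: "'z pmf" and h
    by (rule integrable_pmf_bounded) (rule g)
  have sb: "norm (complex_of_real (step f j z)) \<le> 2 * b" for j z
    using step_bound[of f b] f by simp
  have isg: "integrable (measure_pmf ?Q) (\<lambda>z. of_real (step f j z) * dif g j z)" for j
    by (rule integrable_pmf_bounded, rule norm_mult_bounded[OF sb dif_bound[OF g]])
  have sdb: "norm (complex_of_real (step f j z * dif f j z)) \<le> (2 * b) * (2 * b)" for j z
    using step_dif_bound[OF f, where j = j and z = z] by (simp only: norm_of_real)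
  have isd: "integrable (measure_pmf ?Q) (\<lambda>z. of_real (step f j z * dif f j z) * g (mix {} z))" for j
    by (rule integrable_pmf_bounded, rule norm_mult_bounded[OF sdb g])
  have i3: "integrable (measure_pmf ?Q) (\<lambda>z. \<bar>step f j z\<bar> * (dif f j z)\<^sup>2)" for j
  proof (rule integrable_pmf_bounded)
    show "norm (\<bar>step f j z\<bar> * (dif f j z)\<^sup>2) \<le> 2 * b * (2 * b * (2 * b))" for z
      unfolding power2_eq_square
      by (intro norm_mult_bounded) (use step_bound[of f b] dif_bound[of f b] f in simp_all)
  qed
  have Tb: "norm (complex_of_real (stein f n z)) \<le> n * ((2 * b) * (2 * b))" for z
    using stein_bound[OF f] by simp
  have iT: "integrable (measure_pmf ?Q) (\<lambda>z. of_real (stein f n z) * g (mix {} z))"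
    by (rule integrable_pmf_bounded, rule norm_mult_bounded[OF Tb g])
  have iT': "integrable (measure_pmf ?Q) (\<lambda>z. stein f n z)"
    by (rule integrable_pmf_bounded) (use stein_bound[OF f] in simp)
  have "(\<integral>x. of_real (f x - m) * g x \<partial>measure_pmf ?P)
      = (\<integral>x. of_real (f x) * g x \<partial>measure_pmf ?P) - of_real m * (\<integral>x. g x \<partial>measure_pmf ?P)"
  proof -
    have fb: "norm (complex_of_real (f x)) \<le> b" for x using f by simp
    have "integrable (measure_pmf ?P) (\<lambda>x. of_real (f x) * g x)"
      by (rule integrable_pmf_bounded) (rule norm_mult_bounded[OF fb g])
    then show ?thesis
      using ig[of ?P "\<lambda>x. x"] by (simp add: algebra_simps)
  qed
  also have "\<dots> = (\<Sum>j=1..n. \<integral>z. of_real (step f j z) * dif g j z \<partial>measure_pmf ?Q) / 2"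
    unfolding m_def by (rule covariance_formula[OF f g])
  finally have cov: "(\<integral>x. of_real (f x - m) * g x \<partial>measure_pmf ?P)
    = (\<Sum>j=1..n. \<integral>z. of_real (step f j z) * dif g j z \<partial>measure_pmf ?Q) / 2" .
  have ET: "(\<integral>z. of_real (stein f n z) * g (mix {} z) \<partial>measure_pmf ?Q)
      = (\<Sum>j=1..n. \<integral>z. of_real (step f j z * dif f j z) * g (mix {} z) \<partial>measure_pmf ?Q) / 2"
    unfolding stein_def using isd by (simp add: sum_distrib_right)
  \<comment> \<open>Replacing coordinate \<open>j\<close> multiplies \<open>g\<close> by
    \<open>iexp (- (s * dif f j z))\<close>; the Taylor bound controls the quadratic
    remainder.\<close>
  have pw: "norm (dif g j z - \<i> * of_real (s * dif f j z) * g (mix {} z)) \<le> s\<^sup>2 * (dif f j z)\<^sup>2 / 2" for j z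
  proof -
    have "g (mix {j} z) = g (mix {} z) * iexp (- (s * dif f j z))"
      by (simp add: g_def dif_def algebra_simps flip: exp_add)
    then have "dif g j z - \<i> * of_real (s * dif f j z) * g (mix {} z)
        = - (g (mix {} z) * (iexp (- (s * dif f j z)) - 1 - \<i> * of_real (- (s * dif f j z))))"
      by (simp add: dif_def[of g] algebra_simps)
    also have "norm \<dots> \<le> 1 * ((- (s * dif f j z))\<^sup>2 / 2)"
      unfolding norm_minus_cancel by (rule norm_mult_bounded[OF g iexp_taylor1])
    finally show ?thesis by (simp add: power_mult_distrib)
  qed
  have one: "norm ((\<integral>z. of_real (step f j z) * dif g j z \<partial>measure_pmf ?Q)
      - \<i> * of_real s * (\<integral>z. of_real (step f j z * dif f j z) * g (mix {} z) \<partial>measure_pmf ?Q))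
      \<le> s\<^sup>2 / 2 * (\<integral>z. \<bar>step f j z\<bar> * (dif f j z)\<^sup>2 \<partial>measure_pmf ?Q)" for j
  proof -
    have "(\<integral>z. of_real (step f j z) * dif g j z \<partial>measure_pmf ?Q)
        - \<i> * of_real s * (\<integral>z. of_real (step f j z * dif f j z) * g (mix {} z) \<partial>measure_pmf ?Q)
      = (\<integral>z. of_real (step f j z) * (dif g j z - \<i> * of_real (s * dif f j z) * g (mix {} z)) \<partial>measure_pmf ?Q)"
    proof -
      have "(\<integral>z. of_real (step f j z) * (dif g j z - \<i> * of_real (s * dif f j z) * g (mix {} z)) \<partial>measure_pmf ?Q)
        = (\<integral>z. of_real (step f j z) * dif g j z - \<i> * of_real s * (of_real (step f j z * dif f j z) * g (mix {} z)) \<partial>measure_pmf ?Q)"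
        by (simp add: algebra_simps)
      also have "\<dots> = (\<integral>z. of_real (step f j z) * dif g j z \<partial>measure_pmf ?Q)
        - (\<integral>z. \<i> * of_real s * (of_real (step f j z * dif f j z) * g (mix {} z)) \<partial>measure_pmf ?Q)"
        by (rule Bochner_Integration.integral_diff[OF isg integrable_mult_right[OF isd]])
      also have "(\<integral>z. \<i> * of_real s * (of_real (step f j z * dif f j z) * g (mix {} z)) \<partial>measure_pmf ?Q)
        = \<i> * of_real s * (\<integral>z. of_real (step f j z * dif f j z) * g (mix {} z) \<partial>measure_pmf ?Q)"
        by (rule integral_mult_right_zero)
      finally show ?thesis ..
    qed
    also have "norm \<dots> \<le> (\<integral>z. s\<^sup>2 / 2 * (\<bar>step f j z\<bar> * (dif f j z)\<^sup>2) \<partial>measure_pmf ?Q)"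
    proof (rule norm_expectation_pmf_le)
      show "integrable (measure_pmf ?Q) (\<lambda>z. s\<^sup>2 / 2 * (\<bar>step f j z\<bar> * (dif f j z)\<^sup>2))"
        by (rule integrable_mult_right) (rule i3)
      fix z
      have "norm (complex_of_real (step f j z) * (dif g j z - \<i> * of_real (s * dif f j z) * g (mix {} z)))
          \<le> \<bar>step f j z\<bar> * (s\<^sup>2 * (dif f j z)\<^sup>2 / 2)"
        by (rule norm_mult_bounded) (use pw in simp_all)
      then show "norm (complex_of_real (step f j z) * (dif g j z - \<i> * of_real (s * dif f j z) * g (mix {} z)))
          \<le> s\<^sup>2 / 2 * (\<bar>step f j z\<bar> * (dif f j z)\<^sup>2)"
        by (simp add: algebra_simps)
    qed
    finally show ?thesis by simp
  qed
  \<comment> \<open>The 4 below \<open>\<beta>\<close> combines the factor 1/2 of the covariance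
    formula with the 1/2 of the Taylor remainder.\<close>
  have A: "norm ((\<integral>x. of_real (f x - m) * g x \<partial>measure_pmf ?P)
      - \<i> * of_real s * (\<integral>z. of_real (stein f n z) * g (mix {} z) \<partial>measure_pmf ?Q)) \<le> s\<^sup>2 * (\<beta> / 4)"
  proof -
    have "(\<integral>x. of_real (f x - m) * g x \<partial>measure_pmf ?P)
        - \<i> * of_real s * (\<integral>z. of_real (stein f n z) * g (mix {} z) \<partial>measure_pmf ?Q)
      = (\<Sum>j=1..n. (\<integral>z. of_real (step f j z) * dif g j z \<partial>measure_pmf ?Q)
        - \<i> * of_real s * (\<integral>z. of_real (step f j z * dif f j z) * g (mix {} z) \<partial>measure_pmf ?Q)) / 2"
      unfolding cov ET by (simp add: sum_subtractf sum_distrib_left diff_divide_distrib)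
    also have "norm \<dots> \<le> (\<Sum>j=1..n. s\<^sup>2 / 2 * (\<integral>z. \<bar>step f j z\<bar> * (dif f j z)\<^sup>2 \<partial>measure_pmf ?Q)) / 2"
      unfolding norm_divide by (simp, rule order_trans[OF norm_sum], rule sum_mono) (use one in simp)
    also have "\<dots> = s\<^sup>2 / 4 * (\<Sum>j=1..n. \<integral>z. \<bar>step f j z\<bar> * (dif f j z)\<^sup>2 \<partial>measure_pmf ?Q)"
      by (simp add: sum_distrib_left sum_divide_distrib)
    also have "\<dots> \<le> s\<^sup>2 / 4 * \<beta>"
      by (rule mult_left_mono[OF \<beta>]) simp
    finally show ?thesis by simp
  qed
  have B: "norm ((\<integral>z. of_real (stein f n z) * g (mix {} z) \<partial>measure_pmf ?Q)
      - of_real v * (\<integral>x. g x \<partial>measure_pmf ?P)) \<le> \<tau>"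
  proof -
    have "(\<integral>z. of_real (stein f n z) * g (mix {} z) \<partial>measure_pmf ?Q) - of_real v * (\<integral>x. g x \<partial>measure_pmf ?P)
      = (\<integral>z. of_real (stein f n z - v) * g (mix {} z) \<partial>measure_pmf ?Q)"
      using iT ig[of ?Q "mix {}"] expectation_mix[where h = g and S = "{}" and q = q and d = d and n = n]
      by (simp add: left_diff_distrib)
    also have "norm \<dots> \<le> (\<integral>z. \<bar>stein f n z - v\<bar> \<partial>measure_pmf ?Q)"
    proof (rule norm_expectation_pmf_le)
      show "integrable (measure_pmf ?Q) (\<lambda>z. \<bar>stein f n z - v\<bar>)"
        using iT' by simp
      show "norm (of_real (stein f n z - v) * g (mix {} z)) \<le> \<bar>stein f n z - v\<bar>" for z
        unfolding norm_mult norm_of_real using g[of "mix {} z"] by (simp add: mult_left_le)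
    qed
    finally show ?thesis using \<tau> by linarith
  qed
  let ?\<psi>' = "\<integral>x. \<i> * (of_real (f x - m) * iexp (s * (f x - m))) \<partial>measure_pmf ?P"
  let ?\<psi> = "\<integral>x. iexp (s * (f x - m)) \<partial>measure_pmf ?P"
  let ?A = "\<integral>x. of_real (f x - m) * g x \<partial>measure_pmf ?P"
  let ?T = "\<integral>z. of_real (stein f n z) * g (mix {} z) \<partial>measure_pmf ?Q"
  \<comment> \<open>The terms with \<open>?T\<close> cancel, so the defect of the differential
    equation splits into the errors bounded in \<open>A\<close> and \<open>B\<close>.\<close>
  have "?\<psi>' + of_real (s * v) * ?\<psi>
      = \<i> * (?A - \<i> * of_real s * ?T) - of_real s * (?T - of_real v * ?\<psi>)"
    by (subst integral_mult_right_zero) (simp add: g_def algebra_simps)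
  also have "norm \<dots> \<le> s\<^sup>2 * (\<beta> / 4) + \<bar>s\<bar> * \<tau>"
    using A B unfolding g_def
    by (intro order_trans[OF norm_triangle_ineq4] add_mono) (auto simp: norm_mult intro: mult_left_mono)
  finally show "norm (?\<psi>' + of_real (s * v) * ?\<psi>) \<le> \<bar>s\<bar> * \<tau> + s\<^sup>2 * (\<beta> / 4)"
    by (simp only: add.commute)
qed simp

subsection \<open>The overflow as a function of the selections\<close>

definition cnt :: "nat set \<Rightarrow> (nat \<Rightarrow> 'b) \<Rightarrow> 'b \<Rightarrow> nat" where
  "cnt S x m = card {i \<in> S. x i = m}"

definition excess :: "nat \<Rightarrow> nat \<Rightarrow> (nat \<Rightarrow> 'b) \<Rightarrow> real" where
  "excess r n x = (\<Sum>k=1..n. of_bool (r \<le> cnt {1..<k} x (x k)))"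

lemma cnt_cong: "(\<And>i. i \<in> S \<Longrightarrow> x i = y i) \<Longrightarrow> cnt S x = cnt S y"
  unfolding cnt_def by (intro ext arg_cong[where f = card]) auto

lemma cnt_insert:
  "finite S \<Longrightarrow> j \<notin> S \<Longrightarrow> cnt (insert j S) x m = cnt S x m + of_bool (x j = m)"
proof -
  assume *: "finite S" "j \<notin> S"
  have "{i \<in> insert j S. x i = m} = (if x j = m then insert j {i \<in> S. x i = m} else {i \<in> S. x i = m})"
    by auto
  then show ?thesis using * by (simp add: cnt_def)
qed

lemma excess_bound: "\<bar>excess r n x\<bar> \<le> real n"
proof -
  have "excess r n x \<le> (\<Sum>k=1..n. 1)"
    unfolding excess_def by (intro sum_mono) auto
  moreover have "0 \<le> excess r n x"
    unfolding excess_def by (intro sum_nonneg) auto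
  ultimately show ?thesis by simp
qed

text \<open>Truncated subtraction gives the positive part: one more ball raises the summand of its
  own box by 1 exactly when that box already holds \<open>r\<close> balls.\<close>

lemma sum_cnt_insert:
  assumes "finite S" "j \<notin> S" "finite M" "x j \<in> M"
  shows "(\<Sum>m\<in>M. real (cnt (insert j S) x m - r))
    = (\<Sum>m\<in>M. real (cnt S x m - r)) + of_bool (r \<le> cnt S x (x j))"
proof -
  have "real (cnt (insert j S) x m - r)
      = real (cnt S x m - r) + (if m = x j then of_bool (r \<le> cnt S x (x j)) else 0)" for m
    using assms by (auto simp: cnt_insert)
  then show ?thesis
    using assms by (simp add: sum.distrib)
qed

text \<open>The balls are added one at a time. The resulting expression no longer depends on the
  order of the balls.\<close>

lemma excess_eq_sum:
  assumes "finite M" "x ` {1..n} \<subseteq> M"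
  shows "excess r n x = (\<Sum>m\<in>M. real (cnt {1..n} x m - r))"
  using assms(2)
proof (induction n)
  case 0
  then show ?case by (simp add: excess_def cnt_def)
next
  case (Suc n)
  have "excess r (Suc n) x = excess r n x + of_bool (r \<le> cnt {1..n} x (x (Suc n)))"
    by (simp add: excess_def atLeastLessThanSuc_atLeastAtMost)
  also have "\<dots> = (\<Sum>m\<in>M. real (cnt (insert (Suc n) {1..n}) x m - r))"
  proof -
    have "x ` {1..n} \<subseteq> M" "x (Suc n) \<in> M" using Suc.prems by auto
    then show ?thesis
      using Suc.IH assms(1) by (subst sum_cnt_insert) auto
  qed
  also have "insert (Suc n) {1..n} = {1..Suc n}" by auto
  finally show ?case .
qed

text \<open>By the order-free formula, ball \<open>j\<close> may be treated as the last one. The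
  remaining balls contribute equally to \<open>x\<close> and \<open>y\<close>, and only the overflow
  of ball \<open>j\<close> itself is left.\<close>

lemma excess_diff:
  assumes j: "j \<in> {1..n}" and eq: "\<And>i. i \<in> {1..n} - {j} \<Longrightarrow> x i = y i"
  shows "excess r n x - excess r n y
    = of_bool (r \<le> cnt ({1..n} - {j}) x (x j)) - of_bool (r \<le> cnt ({1..n} - {j}) x (y j))"
proof -
  let ?M = "x ` {1..n} \<union> y ` {1..n}"
  have I: "insert j ({1..n} - {j}) = {1..n}" using j by auto
  have *: "excess r n u = (\<Sum>m\<in>?M. real (cnt ({1..n} - {j}) u m - r)) + of_bool (r \<le> cnt ({1..n} - {j}) u (u j))"
    if "u = x \<or> u = y" for u
  proof -
    have "excess r n u = (\<Sum>m\<in>?M. real (cnt (insert j ({1..n} - {j})) u m - r))"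
      unfolding I using that by (intro excess_eq_sum) auto
    also have "\<dots> = (\<Sum>m\<in>?M. real (cnt ({1..n} - {j}) u m - r)) + of_bool (r \<le> cnt ({1..n} - {j}) u (u j))"
      using that j by (intro sum_cnt_insert) auto
    finally show ?thesis .
  qed
  have "cnt ({1..n} - {j}) y = cnt ({1..n} - {j}) x"
    by (rule cnt_cong) (simp add: eq)
  then show ?thesis
    using *[of x] *[of y] by simp
qed

text \<open>\<open>full r n S j z v\<close>: would ball \<open>j\<close> overflow if it were the last one and chose box \<open>v\<close>?\<close>

definition full :: "nat \<Rightarrow> nat \<Rightarrow> nat set \<Rightarrow> nat \<Rightarrow> (nat \<Rightarrow> 'b \<times> 'b) \<Rightarrow> 'b \<Rightarrow> real" where
  "full r n S j z v = of_bool (r \<le> cnt ({1..n} - {j}) (mix S z) v)"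

lemma full_01: "0 \<le> full r n S j z v" "full r n S j z v \<le> 1"
  by (simp_all add: full_def)

section \<open>Differences of the overflow and the effect of resampling one ball\<close>

lemma dif_excess:
  "j \<in> {1..n} \<Longrightarrow> dif (excess r n) j z = full r n {} j z (fst (z j)) - full r n {} j z (snd (z j))"
  unfolding dif_def full_def by (subst excess_diff[where j = j]) (auto simp: mix_def)

lemma step_excess:
  "j \<in> {1..n} \<Longrightarrow>
    step (excess r n) j z = full r n {1..<j} j z (fst (z j)) - full r n {1..<j} j z (snd (z j))"
  unfolding step_def full_def by (subst excess_diff[where j = j]) (auto simp: mix_def)

lemma dif_excess_le_1: "j \<in> {1..n} \<Longrightarrow> \<bar>dif (excess r n) j z\<bar> \<le> 1"
  by (auto simp: dif_excess full_def)

lemma step_excess_le_1: "j \<in> {1..n} \<Longrightarrow> \<bar>step (excess r n) j z\<bar> \<le> 1"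
  by (auto simp: step_excess full_def)

text \<open>Counting both copies of the other balls dominates the number of balls in box
  \<open>v\<close> for every hybrid \<open>mix S z\<close> at once, and the count is independent of
  coordinate \<open>i\<close>.\<close>

definition others :: "nat \<Rightarrow> nat \<Rightarrow> (nat \<Rightarrow> 'b \<times> 'b) \<Rightarrow> 'b \<Rightarrow> nat" where
  "others n i z v = cnt ({1..n} - {i}) (mix {} z) v + cnt ({1..n} - {i}) (mix UNIV z) v"

lemma others_cong:
  assumes "\<And>k. k \<in> {1..n} - {i} \<Longrightarrow> z k = z' k"
  shows "others n i z = others n i z'"
proof -
  have "cnt ({1..n} - {i}) (mix S z) = cnt ({1..n} - {i}) (mix S z')" for S
    by (rule cnt_cong) (simp add: mix_def assms)
  then show ?thesis by (auto simp: others_def fun_eq_iff)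
qed

lemma others_ge_card:
  assumes "A \<subseteq> {1..n} - {i}" "\<And>k. k \<in> A \<Longrightarrow> fst (z k) = v \<or> snd (z k) = v"
  shows "card A \<le> others n i z v"
proof -
  let ?A = "\<lambda>S. {k \<in> {1..n} - {i}. mix S z k = v}"
  have "card A \<le> card (?A {} \<union> ?A UNIV)"
    using assms by (intro card_mono) (auto simp: mix_def)
  also have "\<dots> \<le> card (?A {}) + card (?A UNIV)"
    by (rule card_Un_le)
  finally show ?thesis by (simp add: others_def cnt_def)
qed

lemma full_le_others: "full r n S i z v \<le> of_bool (r \<le> others n i z v)"
proof -
  have "cnt ({1..n} - {i}) (mix S z) v \<le> others n i z v"
    unfolding cnt_def by (rule others_ge_card) (auto simp: mix_def split: if_splits)
  then show ?thesis by (auto simp: full_def)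
qed

text \<open>The count for box \<open>v\<close> can change only if \<open>v\<close> is an old or new
  selection at \<open>i\<close>. A change also needs at least \<open>r\<close> balls in
  \<open>v\<close> besides ball \<open>j\<close>; if ball \<open>i\<close> is among them, ball
  \<open>j\<close>, one of whose copies lies in \<open>v\<close>, takes its place in the count
  \<open>others n i z v\<close>.\<close>

lemma full_change:
  assumes ij: "i \<in> {1..n}" "j \<in> {1..n}" "j \<noteq> i"
    and eq: "\<And>k. k \<noteq> i \<Longrightarrow> z k = z' k"
    and v: "v = fst (z j) \<or> v = snd (z j)"
  shows "\<bar>full r n S j z v - full r n S j z' v\<bar>
    \<le> of_bool (v \<in> {fst (z i), snd (z i), fst (z' i), snd (z' i)} \<and> r \<le> others n i z v)"
proof (cases "v \<in> {fst (z i), snd (z i), fst (z' i), snd (z' i)}")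
  case False
  have "{k \<in> {1..n} - {j}. mix S z k = v} = {k \<in> {1..n} - {j}. mix S z' k = v}"
  proof (rule Collect_cong)
    fix k
    show "(k \<in> {1..n} - {j} \<and> mix S z k = v) = (k \<in> {1..n} - {j} \<and> mix S z' k = v)"
      using eq[of k] False by (cases "k = i") (auto simp: mix_def)
  qed
  then show ?thesis by (simp add: full_def cnt_def)
next
  case True
  have le: "cnt ({1..n} - {j}) (mix S u) v \<le> others n i z v" if u: "u = z \<or> u = z'" for u
  proof -
    let ?A = "{k \<in> {1..n} - {i, j}. mix S u k = v}"
    have "cnt ({1..n} - {j}) (mix S u) v \<le> card (insert i ?A)"
      unfolding cnt_def by (rule card_mono) auto
    also have "\<dots> = card (insert j ?A)"
      by (simp add: card_insert_if)
    also have "\<dots> \<le> others n i z v"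
    proof (rule others_ge_card)
      fix k assume "k \<in> insert j ?A"
      then show "fst (z k) = v \<or> snd (z k) = v"
        using v u eq[of k] by (auto simp: mix_def split: if_splits)
    qed (use ij in auto)
    finally show ?thesis .
  qed
  show ?thesis
    using True le[of z] le[of z'] by (auto simp: full_def)
qed

text \<open>The weight \<open>2 ^ others n i z v\<close> absorbs the quadratic factor that arises in
  \<open>stein_change\<close> and, unlike a polynomial, factorizes over independent balls.\<close>

definition load :: "nat \<Rightarrow> nat \<Rightarrow> nat \<Rightarrow> (nat \<Rightarrow> 'b \<times> 'b) \<Rightarrow> 'b \<Rightarrow> real" where
  "load r n i z v = of_bool (r \<le> others n i z v) * 2 ^ others n i z v"

lemma load_nonneg: "0 \<le> load r n i z v"
  by (simp add: load_def)

lemma load_cong: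
  assumes "\<And>k. k \<in> {1..n} - {i} \<Longrightarrow> z k = z' k"
  shows "load r n i z = load r n i z'"
  using others_cong[OF assms, where n = n and i = i] by (simp add: load_def fun_eq_iff)

lemma others_le: "others n i z v \<le> 2 * n"
proof -
  have "card {k \<in> {1..n} - {i}. mix S z k = v} \<le> card {1..n}" for S
    by (rule card_mono) auto
  from this[of "{}"] this[of UNIV] show ?thesis
    unfolding others_def cnt_def by simp
qed

lemma load_bound: "\<bar>load r n i z v\<bar> \<le> 2 ^ (2 * n)"
  using others_le[of n i z v] by (auto simp: load_def)

lemma abs_dif_excess_le:
  assumes "j \<in> {1..n}"
  shows "\<bar>dif (excess r n) j z\<bar> \<le> load r n j z (fst (z j)) + load r n j z (snd (z j))"
proof -
  have le: "full r n {} j z v \<le> load r n j z v" for v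
    by (rule order_trans[OF full_le_others]) (auto simp: load_def)
  show ?thesis
    unfolding dif_excess[OF assms]
    using le[of "fst (z j)"] le[of "snd (z j)"] full_01[of r n "{}" j z] load_nonneg[of r n j z]
    by (smt (verit, best))
qed

lemma sum_others:
  "(\<Sum>j\<in>{1..n}-{i}. of_bool (fst (z j) = w) + of_bool (snd (z j) = w)) = (real (others n i z w))"
proof -
  have "(\<Sum>j\<in>A. of_bool (P j) :: real) = real (card {j \<in> A. P j})" if "finite A" for A :: "nat set" and P
    using that by (simp add: Int_def)
  then show ?thesis
    unfolding others_def cnt_def mix_def by (simp add: sum.distrib)
qed

lemma succ_square_le: "(real l + 1)\<^sup>2 \<le> 4 * 2 ^ l"
proof (induction l rule: less_induct)
  case (less l)
  show ?case
  proof (cases "l \<le> 2")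
    case True
    then consider "l = 0" | "l = 1" | "l = 2" by linarith
    then show ?thesis by cases (simp_all add: power2_eq_square)
  next
    case False
    then obtain k where k: "l = Suc k" "k \<ge> 2"
      by (cases l) auto
    have "2 * 2 \<le> real k * real k"
      using k by (intro mult_mono) auto
    then have "(real l + 1)\<^sup>2 \<le> 2 * (real k + 1)\<^sup>2"
      using k by (simp add: power2_eq_square algebra_simps)
    also have "\<dots> \<le> 2 * (4 * 2 ^ k)"
      using less[of k] k by simp
    finally show ?thesis using k by simp
  qed
qed

lemma mult_change:
  fixes a b a' b' :: real
  assumes "\<bar>a\<bar> \<le> 1" "\<bar>b'\<bar> \<le> 1"
  shows "\<bar>a * b - a' * b'\<bar> \<le> \<bar>a - a'\<bar> + \<bar>b - b'\<bar>"
proof -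
  have "a * b - a' * b' = (a - a') * b' + a * (b - b')"
    by (simp add: algebra_simps)
  also have "\<bar>\<dots>\<bar> \<le> \<bar>a - a'\<bar> * \<bar>b'\<bar> + \<bar>a\<bar> * \<bar>b - b'\<bar>"
    by (rule order_trans[OF abs_triangle_ineq]) (simp add: abs_mult)
  also have "\<dots> \<le> \<bar>a - a'\<bar> + \<bar>b - b'\<bar>"
    using assms by (intro add_mono) (auto intro: mult_left_le mult_left_le_one_le)
  finally show ?thesis .
qed

text \<open>Summand \<open>i\<close> changes only if one of the selections at \<open>i\<close> meets
  a box with at least \<open>r\<close> other selections. Any other summand \<open>j\<close> changes
  only if, moreover, a copy of ball \<open>j\<close> lies in such a box; summing over
  \<open>j\<close> counts these balls and gives the factor \<open>others + 1\<close>. After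
  squaring, \<open>succ_square_le\<close> trades this factor for the exponential weight.\<close>

lemma stein_change:
  assumes i: "i \<in> {1..n}" and eq: "\<And>k. k \<noteq> i \<Longrightarrow> z k = z' k"
  shows "(stein (excess r n) n z - stein (excess r n) n z')\<^sup>2
    \<le> 16 * (load r n i z (fst (z i)) + load r n i z (snd (z i))
      + load r n i z' (fst (z' i)) + load r n i z' (snd (z' i)))"
proof -
  let ?f = "excess r n"
  define ob where "ob v = (of_bool (r \<le> others n i z v) :: real)" for v
  define G where "G v = ob v * (real (others n i z v) + 1)" for v
  \<comment> \<open>\<open>W\<close> sums over the four boxes involved: both copies of coordinate
    \<open>i\<close>, before and after the change.\<close>
  define W where "W g = g (fst (z i)) + g (snd (z i)) + g (fst (z' i)) + g (snd (z' i))" for g :: "'a \<Rightarrow> real"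
  have ob': "ob v = of_bool (r \<le> others n i z' v)" for v
    unfolding ob_def using others_cong[of n i z z'] eq by simp
  have W_mono: "W g \<le> W h" if "\<And>v. g v \<le> h v" for g h
    unfolding W_def by (intro add_mono that)
  have diag: "\<bar>step ?f i z * dif ?f i z - step ?f i z' * dif ?f i z'\<bar> \<le> W ob"
  proof -
    have le: "\<bar>step ?f i u * dif ?f i u\<bar> \<le> ob (fst (u i)) + ob (snd (u i))" if u: "u = z \<or> u = z'" for u
    proof -
      have "\<bar>step ?f i u * dif ?f i u\<bar> \<le> 1 * \<bar>dif ?f i u\<bar>"
        unfolding abs_mult by (intro mult_right_mono step_excess_le_1 i) simp
      also have "\<dots> \<le> full r n {} i u (fst (u i)) + full r n {} i u (snd (u i))"
        unfolding dif_excess[OF i] using full_01[of r n "{}" i u] by (smt (verit, best))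
      also have "\<dots> \<le> ob (fst (u i)) + ob (snd (u i))"
      proof -
        have "ob v = of_bool (r \<le> others n i u v)" for v
          using u ob'[of v] ob_def[of v] by metis
        then show ?thesis
          using full_le_others[of r n "{}" i u] by (intro add_mono) simp_all
      qed
      finally show ?thesis .
    qed
    show ?thesis
      using le[OF disjI1[OF refl]] le[OF disjI2[OF refl]] unfolding W_def by linarith
  qed
  have off: "\<bar>step ?f j z * dif ?f j z - step ?f j z' * dif ?f j z'\<bar>
      \<le> 2 * W (\<lambda>w. ob w * (of_bool (fst (z j) = w) + of_bool (snd (z j) = w)))"
    if j: "j \<in> {1..n} - {i}" for j
  proof -
    let ?W = "{fst (z i), snd (z i), fst (z' i), snd (z' i)}"
    define c where "c v = (of_bool (v \<in> ?W \<and> r \<le> others n i z v) :: real)" for v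
    have j': "j \<in> {1..n}" "j \<noteq> i" using j by auto
    have zj: "z' j = z j" using eq[of j] j' by simp
    have ch: "\<bar>full r n S j z v - full r n S j z' v\<bar> \<le> c v" if "v = fst (z j) \<or> v = snd (z j)" for S v
      unfolding c_def by (rule full_change) (use i j' eq that in auto)
    have tri: "\<bar>a - b - (a' - b')\<bar> \<le> e + e'" if "\<bar>a - a'\<bar> \<le> e" "\<bar>b - b'\<bar> \<le> e'" for a b a' b' e e' :: real
      using that by linarith
    have arith: "x + y \<le> 2 * (a' + b')" if "x \<le> a + b" "y \<le> a + b" "a \<le> a'" "b \<le> b'" for a b a' b' x y :: real
      using that by simp
    have d: "\<bar>dif ?f j z - dif ?f j z'\<bar> \<le> c (fst (z j)) + c (snd (z j))"
      unfolding dif_excess[OF j'(1)] zj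
      by (rule tri) (rule ch, simp)+
    have s: "\<bar>step ?f j z - step ?f j z'\<bar> \<le> c (fst (z j)) + c (snd (z j))"
      unfolding step_excess[OF j'(1)] zj
      by (rule tri) (rule ch, simp)+
    \<comment> \<open>A union bound over the four boxes, with the fullness condition moved from
      \<open>v\<close> to the box it coincides with.\<close>
    have c: "c v \<le> W (\<lambda>w. ob w * of_bool (v = w))" for v
    proof -
      have "ob w * of_bool (v = w) = ob v * of_bool (v = w)" for w by simp
      then have "W (\<lambda>w. ob w * of_bool (v = w)) = ob v * W (\<lambda>w. of_bool (v = w))"
        by (simp only: W_def distrib_left)
      moreover have "of_bool (v \<in> ?W) \<le> W (\<lambda>w. of_bool (v = w))"
        by (auto simp: W_def)
      moreover have "c v = ob v * of_bool (v \<in> ?W)"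
        by (simp only: c_def ob_def of_bool_conj mult.commute)
      ultimately show ?thesis
        by (simp add: ob_def)
    qed
    have "\<bar>step ?f j z * dif ?f j z - step ?f j z' * dif ?f j z'\<bar>
        \<le> \<bar>step ?f j z - step ?f j z'\<bar> + \<bar>dif ?f j z - dif ?f j z'\<bar>"
      by (rule mult_change[OF step_excess_le_1 dif_excess_le_1]) (rule j')+
    also have "\<dots> \<le> 2 * (W (\<lambda>w. ob w * of_bool (fst (z j) = w)) + W (\<lambda>w. ob w * of_bool (snd (z j) = w)))"
      by (rule arith[OF s d c c])
    also have "\<dots> = 2 * W (\<lambda>w. ob w * (of_bool (fst (z j) = w) + of_bool (snd (z j) = w)))"
      by (simp add: W_def distrib_left)
    finally show ?thesis .
  qed
  have "\<bar>stein ?f n z - stein ?f n z'\<bar>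
      = \<bar>\<Sum>j=1..n. step ?f j z * dif ?f j z - step ?f j z' * dif ?f j z'\<bar> / 2"
    by (simp add: stein_def sum_subtractf flip: diff_divide_distrib)
  also have "\<dots> \<le> (\<Sum>j=1..n. \<bar>step ?f j z * dif ?f j z - step ?f j z' * dif ?f j z'\<bar>) / 2"
    by (intro divide_right_mono sum_abs) simp
  also have "(\<Sum>j=1..n. \<bar>step ?f j z * dif ?f j z - step ?f j z' * dif ?f j z'\<bar>)
      = \<bar>step ?f i z * dif ?f i z - step ?f i z' * dif ?f i z'\<bar>
      + (\<Sum>j\<in>{1..n}-{i}. \<bar>step ?f j z * dif ?f j z - step ?f j z' * dif ?f j z'\<bar>)"
    by (rule sum.remove) (use i in auto)
  also have "\<dots> \<le> W ob
      + (\<Sum>j\<in>{1..n}-{i}. 2 * W (\<lambda>w. ob w * (of_bool (fst (z j) = w) + of_bool (snd (z j) = w))))"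
    by (intro add_mono diag sum_mono off)
  also have "(\<Sum>j\<in>{1..n}-{i}. 2 * W (\<lambda>w. ob w * (of_bool (fst (z j) = w) + of_bool (snd (z j) = w))))
      = 2 * W (\<lambda>w. ob w * (\<Sum>j\<in>{1..n}-{i}. of_bool (fst (z j) = w) + of_bool (snd (z j) = w)))"
    by (simp only: W_def sum.distrib sum_distrib_left distrib_left)
  also have "\<dots> = 2 * W (\<lambda>w. ob w * real (others n i z w))"
    by (simp only: sum_others)
  also have "W ob + \<dots> \<le> 2 * W G"
  proof -
    have "W G = W ob + W (\<lambda>w. ob w * real (others n i z w))"
      by (simp add: W_def G_def distrib_left)
    moreover have "0 \<le> W ob" by (simp add: W_def ob_def)
    ultimately show ?thesis by linarith
  qed
  finally have T: "\<bar>stein ?f n z - stein ?f n z'\<bar> \<le> W G" by simp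
  have sq4: "(a + b + c + e)\<^sup>2 \<le> 4 * (a\<^sup>2 + b\<^sup>2 + c\<^sup>2 + e\<^sup>2)" for a b c e :: real
  proof -
    have "4 * (a\<^sup>2 + b\<^sup>2 + c\<^sup>2 + e\<^sup>2) - (a + b + c + e)\<^sup>2
      = (a-b)\<^sup>2 + (a-c)\<^sup>2 + (a-e)\<^sup>2 + (b-c)\<^sup>2 + (b-e)\<^sup>2 + (c-e)\<^sup>2"
      by (simp add: power2_eq_square algebra_simps)
    moreover have "\<dots> \<ge> 0" by simp
    ultimately show ?thesis by linarith
  qed
  have "(stein ?f n z - stein ?f n z')\<^sup>2 \<le> (W G)\<^sup>2"
    using power_mono[OF T abs_ge_zero, of 2] by simp
  also have "\<dots> \<le> 4 * W (\<lambda>v. (G v)\<^sup>2)"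
    unfolding W_def by (rule sq4)
  also have "\<dots> \<le> 4 * W (\<lambda>v. 4 * load r n i z v)"
  proof -
    have "(G v)\<^sup>2 \<le> 4 * load r n i z v" for v
      using succ_square_le[of "others n i z v"]
      by (cases "r \<le> others n i z v") (simp_all add: G_def load_def ob_def)
    then have "W (\<lambda>v. (G v)\<^sup>2) \<le> W (\<lambda>v. 4 * load r n i z v)"
      by (rule W_mono)
    then show ?thesis by (rule mult_left_mono) simp
  qed
  also have "\<dots> = 16 * W (load r n i z)"
    unfolding W_def by (simp add: algebra_simps)
  finally have "(stein ?f n z - stein ?f n z')\<^sup>2 \<le> 16 * W (load r n i z)" .
  moreover have "load r n i z' = load r n i z"
    by (rule load_cong) (simp add: eq)
  ultimately show ?thesis
    by (simp only: W_def)
qed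

subsection \<open>Upper bounds\<close>

text \<open>Fubini with coordinate \<open>i\<close> split off. By \<open>indep\<close> the second
  argument of \<open>F\<close> may carry the default value at \<open>i\<close> instead of the drawn
  one.\<close>

lemma expectation_iid_split:
  fixes F :: "'b \<Rightarrow> (nat \<Rightarrow> 'b) \<Rightarrow> real"
  assumes i: "i \<in> {1..n}" and b: "\<And>y z. \<bar>F y z\<bar> \<le> b"
    and indep: "\<And>y z z'. (\<And>k. k \<noteq> i \<Longrightarrow> z k = z' k) \<Longrightarrow> F y z = F y z'"
  shows "(\<integral>z. F (z i) z \<partial>measure_pmf (iid q d n))
    = (\<integral>y. \<integral>z. F y z \<partial>measure_pmf (Pi_pmf ({1..n} - {i}) d (\<lambda>_. q)) \<partial>measure_pmf q)"
proof -
  let ?P = "Pi_pmf ({1..n} - {i}) d (\<lambda>_. q)"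
  have "iid q d n = Pi_pmf (insert i ({1..n} - {i})) d (\<lambda>_. q)"
    using i by (simp add: iid_def insert_absorb)
  also have "\<dots> = map_pmf (\<lambda>(y, f). f(i := y)) (pair_pmf q ?P)"
    by (rule Pi_pmf_insert) auto
  finally have "(\<integral>z. F (z i) z \<partial>measure_pmf (iid q d n))
      = (\<integral>z. F (fst z) ((snd z)(i := fst z)) \<partial>measure_pmf (pair_pmf q ?P))"
    by (simp add: case_prod_beta)
  also have "\<dots> = (\<integral>z. F (fst z) (snd z) \<partial>measure_pmf (pair_pmf q ?P))"
    by (intro Bochner_Integration.integral_cong indep) auto
  also have "\<dots> = (\<integral>y. \<integral>z. F y z \<partial>measure_pmf ?P \<partial>measure_pmf q)"
    by (subst expectation_pair_pmf) (auto intro: b)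
  finally show ?thesis .
qed

lemma integral_of_bool_pmf:
  "(\<integral>x. of_bool (x = v) \<partial>measure_pmf q) = pmf q v"
proof -
  have "(\<lambda>x. of_bool (x = v) :: real) = indicator {v}"
    by (auto simp: indicator_def)
  then show ?thesis by (simp add: measure_pmf_single)
qed

lemma prod_cnt:
  "finite A \<Longrightarrow> (\<Prod>k\<in>A. 1 + (c - 1) * of_bool (x k = v)) = (c :: real) ^ cnt A x v"
proof (induction A rule: finite_induct)
  case (insert j A)
  then show ?case by (cases "x j = v") (auto simp: cnt_insert)
qed (simp add: cnt_def)

text \<open>A Chernoff bound: \<open>of_bool (r \<le> L) * 2 ^ L \<le> (2 * s) ^ L / s ^ r\<close> for every \<open>s \<ge> 1\<close>.\<close>

lemma expectation_load_le:
  fixes q :: "'b pmf"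
  assumes i: "i \<in> {1..n}" and s: "1 \<le> s"
  shows "(\<integral>z. load r n i z v \<partial>measure_pmf (Pi_pmf ({1..n} - {i}) (d, d) (\<lambda>_. pair_pmf q q)))
    \<le> (1 + (2 * s - 1) * pmf q v) ^ (2 * (n - 1)) / s ^ r"
proof -
  let ?A = "{1..n} - {i}"
  let ?P = "Pi_pmf ?A (d, d) (\<lambda>_. pair_pmf q q)"
  \<comment> \<open>\<open>h\<close> is \<open>2 * s\<close> at \<open>v\<close> and 1 elsewhere, so
    its product over both copies of the other balls is
    \<open>(2 * s) ^ others n i z v\<close>.\<close>
  define h where "h x = 1 + (2 * s - 1) * of_bool (x = v)" for x
  have h0: "0 \<le> h x" and h1: "\<bar>h x\<bar> \<le> 2 * s" for x
    using s by (auto simp: h_def)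
  have ih: "integrable (measure_pmf q) h"
    by (rule integrable_pmf_bounded) (use h1 in simp)
  have hb: "\<bar>h (fst y) * h (snd y)\<bar> \<le> 2 * s * (2 * s)" for y
    unfolding abs_mult by (intro mult_mono h1) (use s in auto)
  have ihh: "integrable (measure_pmf (pair_pmf q q)) (\<lambda>y. h (fst y) * h (snd y))"
    by (rule integrable_pmf_bounded) (use hb in simp)
  have Eh: "(\<integral>x. h x \<partial>measure_pmf q) = 1 + (2 * s - 1) * pmf q v"
  proof -
    have "integrable (measure_pmf q) (\<lambda>x. of_bool (x = v) :: real)"
      by (rule integrable_pmf_bounded[where b = 1]) auto
    then show ?thesis
      unfolding h_def by (subst Bochner_Integration.integral_add) (simp_all add: integral_of_bool_pmf)
  qed
  have Ehh: "(\<integral>y. h (fst y) * h (snd y) \<partial>measure_pmf (pair_pmf q q)) = (1 + (2 * s - 1) * pmf q v)\<^sup>2"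
    using hb by (subst expectation_pair_pmf) (simp_all add: Eh power2_eq_square)
  have pr: "(\<Prod>k\<in>?A. h (fst (z k)) * h (snd (z k))) = (2 * s) ^ others n i z v" for z :: "nat \<Rightarrow> 'b \<times> 'b"
    using prod_cnt[of ?A "2 * s" "mix {} z" v] prod_cnt[of ?A "2 * s" "mix UNIV z" v]
    by (simp add: prod.distrib h_def others_def power_add mix_def)
  have "(\<integral>z. load r n i z v \<partial>measure_pmf ?P)
      \<le> (\<integral>z. (\<Prod>k\<in>?A. h (fst (z k)) * h (snd (z k))) / s ^ r \<partial>measure_pmf ?P)"
  proof (rule integral_mono)
    show "integrable (measure_pmf ?P) (\<lambda>z. load r n i z v)"
      by (rule integrable_pmf_bounded) (use load_bound in simp)
    show "integrable (measure_pmf ?P) (\<lambda>z. (\<Prod>k\<in>?A. h (fst (z k)) * h (snd (z k))) / s ^ r)"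
      by (intro integrable_divide integrable_prod_Pi_pmf ihh) auto
    show "load r n i z v \<le> (\<Prod>k\<in>?A. h (fst (z k)) * h (snd (z k))) / s ^ r" for z
    proof (cases "r \<le> others n i z v")
      case True
      then have "s ^ r \<le> s ^ others n i z v"
        using s by (rule power_increasing)
      then have "2 ^ others n i z v * s ^ r \<le> 2 ^ others n i z v * s ^ others n i z v"
        by (intro mult_left_mono) auto
      then show ?thesis
        unfolding pr load_def using True s by (simp add: field_simps)
    qed (use s h0 in \<open>simp add: load_def prod_nonneg\<close>)
  qed
  also have "\<dots> = (\<Prod>k\<in>?A. (1 + (2 * s - 1) * pmf q v)\<^sup>2) / s ^ r"
    using expectation_prod_Pi_pmf[of ?A "\<lambda>_. pair_pmf q q" "\<lambda>_ y. h (fst y) * h (snd y)" "(d, d)"] h0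
    by (simp add: ihh Ehh)
  also have "\<dots> = (1 + (2 * s - 1) * pmf q v) ^ (2 * (n - 1)) / s ^ r"
    using i by (simp add: power_mult)
  finally show ?thesis .
qed

text \<open>With this normalization \<open>real n * intensity q r n\<close> is \<open>\<mu>\<close>
  of the overview.\<close>

definition intensity :: "'b pmf \<Rightarrow> nat \<Rightarrow> nat \<Rightarrow> real" where
  "intensity q r n = (\<integral>v. (real n * pmf q v) ^ r \<partial>measure_pmf q)"

lemma intensity_integrable: "integrable (measure_pmf q) (\<lambda>v. (real n * pmf q v) ^ r)"
  by (rule integrable_pmf_bounded[where b = "real n ^ r"])
    (simp add: power_mult_distrib mult_left_le power_le_one pmf_le_1)

lemma intensity_nonneg: "0 \<le> intensity q r n"
  unfolding intensity_def by (intro integral_nonneg_AE) auto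

text \<open>The load of a fixed box is independent of coordinate \<open>i\<close>. Given that ball
  \<open>i\<close> selects \<open>v\<close>, the Chernoff bound is of order
  \<open>(real n * pmf q v) ^ r\<close>, and averaging over \<open>v\<close> yields the
  intensity.\<close>

lemma expectation_load_fst:
  fixes q :: "'b pmf"
  assumes i: "i \<in> {1..n}" and C: "1 \<le> C" "\<And>v. real n * pmf q v \<le> C"
  shows "(\<integral>z. load r n i z (fst (z i)) \<partial>measure_pmf (iid2 q d n)) \<le> exp (4 * C) * intensity q r n"
proof -
  let ?P = "Pi_pmf ({1..n} - {i}) (d, d) (\<lambda>_. pair_pmf q q)"
  have n: "0 < n" using i by simp
  have bd: "\<bar>\<integral>z. load r n i z v \<partial>measure_pmf ?P\<bar> \<le> 2 ^ (2 * n)" for v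
    by (rule expectation_pmf_abs_le) (rule load_bound)
  have le: "(\<integral>z. load r n i z v \<partial>measure_pmf ?P) \<le> exp (4 * C) * (real n * pmf q v) ^ r"
    if v: "v \<in> set_pmf q" for v
  proof -
    define p where "p = pmf q v"
    \<comment> \<open>The Chernoff parameter is tuned to the box: \<open>s * p = C / real n\<close>
      keeps the exponential factor below \<open>exp (4 * C)\<close>, while \<open>1 / s ^ r\<close>
      supplies the power of \<open>real n * p\<close>. Here \<open>p\<close> is positive since
      \<open>v\<close> lies in the support.\<close>
    define s where "s = C / (real n * p)"
    have p: "0 < p" "real n * p \<le> C"
      using v C(2)[of v] by (auto simp: p_def pmf_positive)
    have s: "1 \<le> s" "s * p = C / real n"
      using p n by (auto simp: s_def field_simps)
    have "1 + (2 * s - 1) * p \<le> exp (2 * s * p)"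
    proof -
      have "(2 * s - 1) * p \<le> 2 * s * p"
        using p by (intro mult_right_mono) auto
      then show ?thesis
        using exp_ge_add_one_self[of "2 * s * p"] by linarith
    qed
    moreover have "0 \<le> 1 + (2 * s - 1) * p"
      using s p by simp
    ultimately have "(1 + (2 * s - 1) * p) ^ (2 * (n - 1)) \<le> exp (2 * s * p) ^ (2 * (n - 1))"
      by (intro power_mono)
    also have "\<dots> \<le> exp (2 * s * p) ^ (2 * n)"
      using s p by (intro power_increasing) auto
    also have "\<dots> = exp (4 * (real n * (s * p)))"
      by (simp flip: exp_of_nat_mult add: mult_ac)
    also have "\<dots> = exp (4 * C)"
      using n s by simp
    finally have num: "(1 + (2 * s - 1) * p) ^ (2 * (n - 1)) \<le> exp (4 * C)" .
    have "(\<integral>z. load r n i z v \<partial>measure_pmf ?P) \<le> (1 + (2 * s - 1) * p) ^ (2 * (n - 1)) / s ^ r"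
      unfolding p_def by (rule expectation_load_le[OF i s(1)])
    also have "\<dots> \<le> exp (4 * C) / s ^ r"
      using num s by (intro divide_right_mono) auto
    also have "\<dots> = exp (4 * C) * ((real n * p) ^ r / C ^ r)"
      using p n C by (simp add: s_def power_divide)
    also have "\<dots> \<le> exp (4 * C) * (real n * p) ^ r"
    proof -
      have "1 \<le> C ^ r" using C by simp
      then have "(real n * p) ^ r / C ^ r \<le> (real n * p) ^ r / 1"
        using p by (intro divide_left_mono zero_le_power) auto
      from mult_left_mono[OF this, of "exp (4 * C)"] show ?thesis by simp
    qed
    finally show ?thesis by (simp add: p_def)
  qed
  have "(\<integral>z. load r n i z (fst (z i)) \<partial>measure_pmf (iid2 q d n))
      = (\<integral>y. \<integral>z. load r n i z (fst y) \<partial>measure_pmf ?P \<partial>measure_pmf (pair_pmf q q))"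
    by (rule expectation_iid_split[OF i load_bound]) (metis load_cong DiffD2 singletonI)
  also have "\<dots> = (\<integral>v. \<integral>z. load r n i z v \<partial>measure_pmf ?P \<partial>measure_pmf q)"
    by (rule expectation_pair_pmf_fst)
  also have "\<dots> \<le> (\<integral>v. exp (4 * C) * (real n * pmf q v) ^ r \<partial>measure_pmf q)"
  proof (rule integral_mono_AE)
    show "integrable (measure_pmf q) (\<lambda>v. \<integral>z. load r n i z v \<partial>measure_pmf ?P)"
      by (rule integrable_pmf_bounded) (use bd in simp)
    show "integrable (measure_pmf q) (\<lambda>v. exp (4 * C) * (real n * pmf q v) ^ r)"
      by (intro integrable_mult_right intensity_integrable)
  qed (intro AE_pmfI le)
  finally show ?thesis by (simp add: intensity_def)
qed

lemma others_swap: "others n i (swap_on UNIV z) = others n i z"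
  by (auto simp: others_def mix_swap_on fun_eq_iff)

lemma expectation_load_snd:
  "(\<integral>z. load r n i z (snd (z i)) \<partial>measure_pmf (iid2 q d n))
    = (\<integral>z. load r n i z (fst (z i)) \<partial>measure_pmf (iid2 q d n))"
  using expectation_swap_on[where h = "\<lambda>z. load r n i z (fst (z i))" and S = UNIV and q = q and d = d and n = n]
  by (simp add: load_def others_swap) (simp add: swap_on_def)

lemma load_integrable: "integrable (measure_pmf M) (\<lambda>z. load r n i (g z) (h z))"
  by (rule integrable_pmf_bounded) (use load_bound in simp)

lemma expectation_abs_dif_excess:
  assumes i: "i \<in> {1..n}" and C: "1 \<le> C" "\<And>v. real n * pmf q v \<le> C"
  shows "(\<integral>z. \<bar>dif (excess r n) i z\<bar> \<partial>measure_pmf (iid2 q d n)) \<le> 2 * exp (4 * C) * intensity q r n"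
proof -
  have "(\<integral>z. \<bar>dif (excess r n) i z\<bar> \<partial>measure_pmf (iid2 q d n))
      \<le> (\<integral>z. load r n i z (fst (z i)) + load r n i z (snd (z i)) \<partial>measure_pmf (iid2 q d n))"
  proof (rule integral_mono)
    show "integrable (measure_pmf (iid2 q d n)) (\<lambda>z. \<bar>dif (excess r n) i z\<bar>)"
      by (rule integrable_pmf_bounded) (use dif_excess_le_1[OF i] in simp)
  qed (auto intro!: load_integrable abs_dif_excess_le i)
  also have "\<dots> = 2 * (\<integral>z. load r n i z (fst (z i)) \<partial>measure_pmf (iid2 q d n))"
    by (subst Bochner_Integration.integral_add[OF load_integrable load_integrable])
      (simp add: expectation_load_snd)
  finally show ?thesis
    using expectation_load_fst[OF i C, where r = r and d = d] by linarith
qed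

text \<open>The Efron-Stein inequality is applied to \<open>stein\<close> as a function of
  \<open>n\<close> independent pairs, hence the second doubling in \<open>?Q\<close>. Each squared
  difference is bounded by four loads of equal expectation.\<close>

lemma variance_stein_le:
  fixes q :: "'b pmf"
  assumes C: "1 \<le> C" "\<And>v. real n * pmf q v \<le> C"
  shows "measure_pmf.variance (iid2 q d n) (stein (excess r n) n)
    \<le> 32 * exp (4 * C) * (real n * intensity q r n)"
proof -
  let ?T = "stein (excess r n) n"
  let ?Q = "iid2 (pair_pmf q q) (d, d) n"
  have T0: "\<bar>?T z\<bar> \<le> real n * ((2 * real n) * (2 * real n))" for z :: "nat \<Rightarrow> 'b \<times> 'b"
    by (rule stein_bound) (rule excess_bound)
  have "(\<integral>z. (dif ?T i z)\<^sup>2 \<partial>measure_pmf ?Q) \<le> 64 * exp (4 * C) * intensity q r n"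
    if i: "i \<in> {1..n}" for i
  proof -
    let ?l = "\<lambda>z. load r n i z (fst (z i))" and ?m = "\<lambda>z. load r n i z (snd (z i))"
    have int: "integrable (measure_pmf ?Q) (\<lambda>z. ?l (mix S z))"
      "integrable (measure_pmf ?Q) (\<lambda>z. ?m (mix S z))" for S
      by (rule load_integrable)+
    have "(\<integral>z. (dif ?T i z)\<^sup>2 \<partial>measure_pmf ?Q)
        \<le> (\<integral>z. 16 * (?l (mix {} z) + ?m (mix {} z) + ?l (mix {i} z) + ?m (mix {i} z)) \<partial>measure_pmf ?Q)"
    proof (rule integral_mono)
      have Tb: "norm (dif ?T i z) \<le> 2 * (real n * ((2 * real n) * (2 * real n)))" for z :: "nat \<Rightarrow> ('b \<times> 'b) \<times> ('b \<times> 'b)"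
        by (rule dif_bound) (use T0 in simp)
      show "integrable (measure_pmf ?Q) (\<lambda>z. (dif ?T i z)\<^sup>2)"
        unfolding power2_eq_square
        by (rule integrable_pmf_bounded) (rule norm_mult_bounded[OF Tb Tb])
      show "(dif ?T i z)\<^sup>2 \<le> 16 * (?l (mix {} z) + ?m (mix {} z) + ?l (mix {i} z) + ?m (mix {i} z))" for z :: "nat \<Rightarrow> ('b \<times> 'b) \<times> ('b \<times> 'b)"
        unfolding dif_def by (rule stein_change[OF i]) (simp add: mix_def)
    qed (intro integrable_mult_right Bochner_Integration.integrable_add int)
    also have "\<dots> = 64 * (\<integral>z. load r n i z (fst (z i)) \<partial>measure_pmf (iid2 q d n))"
      using expectation_mix[where h = ?l and q = "pair_pmf q q" and d = "(d, d)" and n = n]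
        expectation_mix[where h = ?m and q = "pair_pmf q q" and d = "(d, d)" and n = n]
      by (simp add: int expectation_load_snd)
    finally show ?thesis
      using expectation_load_fst[OF i C, where r = r and d = d] by simp
  qed
  then have "(\<Sum>i=1..n. \<integral>z. (dif ?T i z)\<^sup>2 \<partial>measure_pmf ?Q) / 2
      \<le> (\<Sum>i=1..n. 64 * exp (4 * C) * intensity q r n) / 2"
    by (intro divide_right_mono sum_mono) auto
  also have "\<dots> = 32 * exp (4 * C) * (real n * intensity q r n)"
    by simp
  finally show ?thesis
    by (rule order_trans[OF efron_stein[OF T0]])
qed

subsection \<open>Lower bound for the variance\<close>

text \<open>Given the coordinates from \<open>j\<close> on, \<open>step\<close> and \<open>dif\<close> are independent copies of each other;
  the square below is that of their conditional expectation.\<close>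

lemma expectation_step_dif:
  fixes q :: "'b pmf" and r :: nat
  assumes j: "j \<in> {1..n}"
  defines "\<Phi> w x \<equiv> of_bool (r \<le> cnt {1..<j} x (fst (w j)) + cnt {Suc j..n} (mix {} w) (fst (w j)))
    - of_bool (r \<le> cnt {1..<j} x (snd (w j)) + cnt {Suc j..n} (mix {} w) (snd (w j))) :: real"
  shows "(\<integral>z. step (excess r n) j z * dif (excess r n) j z \<partial>measure_pmf (iid2 q d n))
    = (\<integral>w. (\<integral>x. \<Phi> w x \<partial>measure_pmf (iid q d (j - 1)))\<^sup>2
        \<partial>measure_pmf (Pi_pmf {j..n} (d, d) (\<lambda>_. pair_pmf q q)))"
proof -
  let ?B = "Pi_pmf {j..n} (d, d) (\<lambda>_. pair_pmf q q)" and ?A = "iid2 q d (j - 1)"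
  let ?m = "\<lambda>u w i. if i \<in> {1..<j} then u i else w i"
  have \<Phi>1: "\<bar>\<Phi> w x\<bar> \<le> 1" for w x by (simp add: \<Phi>_def)
  have \<Phi>2: "\<bar>\<Phi> w x * \<Phi> w y\<bar> \<le> 1" for w x y
    using mult_mono[OF \<Phi>1 \<Phi>1, of w x w y] by (simp add: abs_mult mult.commute)
  have A: "?A = Pi_pmf {1..<j} (d, d) (\<lambda>_. pair_pmf q q)"
  proof -
    have "{1..j - 1} = {1..<j}" using j by auto
    then show ?thesis by (simp add: iid_def)
  qed
  have I: "{1..n} = {1..<j} \<union> {j..n}"
    using j by (intro ivl_disj_un_two(7)[symmetric]) auto
  have split: "iid2 q d n = map_pmf (\<lambda>(u, w). ?m u w) (pair_pmf ?A ?B)"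
    unfolding A unfolding iid_def I by (rule Pi_pmf_union) auto
  have cnt_split: "cnt ({1..n} - {j}) x v = cnt {1..<j} x v + cnt {Suc j..n} x v" for x :: "nat \<Rightarrow> 'b" and v
  proof -
    have eq: "{i \<in> {1..n} - {j}. x i = v} = {i \<in> {1..<j}. x i = v} \<union> {i \<in> {Suc j..n}. x i = v}"
      using j by auto
    show ?thesis
      unfolding cnt_def eq by (rule card_Un_disjoint) auto
  qed
  have full: "full r n S j (?m u w) v
      = of_bool (r \<le> cnt {1..<j} (mix S u) v + cnt {Suc j..n} (mix {} w) v)"
    if S: "S \<subseteq> {1..<j}" for S v u and w :: "nat \<Rightarrow> 'b \<times> 'b"
  proof -
    have "cnt {1..<j} (mix S (?m u w)) = cnt {1..<j} (mix S u)"
      by (rule cnt_cong) (simp add: mix_def)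
    moreover have "cnt {Suc j..n} (mix S (?m u w)) = cnt {Suc j..n} (mix {} w)"
      by (rule cnt_cong) (use S in \<open>auto simp: mix_def\<close>)
    ultimately show ?thesis
      unfolding full_def cnt_split by simp
  qed
  \<comment> \<open>Before \<open>j\<close>, \<open>dif\<close> reads the originals and
    \<open>step\<close> the copies; after \<open>j\<close> both read the originals. Given
    \<open>w\<close>, they are therefore the same function \<open>\<Phi> w\<close> of two
    independent samples.\<close>
  have dif: "dif (excess r n) j (?m u w) = \<Phi> w (mix {} u)" for u w
    unfolding dif_excess[OF j] by (subst (1 2) full) (auto simp: \<Phi>_def)
  have step: "step (excess r n) j (?m u w) = \<Phi> w (mix UNIV u)" for u w
  proof -
    have "cnt {1..<j} (mix {1..<j} u) = cnt {1..<j} (mix UNIV u)"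
      by (rule cnt_cong) (simp add: mix_def)
    then show ?thesis
      unfolding step_excess[OF j] by (subst (1 2) full) (auto simp: \<Phi>_def)
  qed
  have "(\<integral>z. step (excess r n) j z * dif (excess r n) j z \<partial>measure_pmf (iid2 q d n))
      = (\<integral>z. \<Phi> (snd z) (mix UNIV (fst z)) * \<Phi> (snd z) (mix {} (fst z)) \<partial>measure_pmf (pair_pmf ?A ?B))"
    unfolding split by (simp only: integral_map_pmf case_prod_beta dif step)
  also have "pair_pmf ?A ?B = map_pmf prod.swap (pair_pmf ?B ?A)"
  proof -
    have "prod.swap = (\<lambda>(x :: nat \<Rightarrow> 'b \<times> 'b, y :: nat \<Rightarrow> 'b \<times> 'b). (y, x))" by auto
    then show ?thesis by (simp only: pair_commute_pmf[of ?A ?B])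
  qed
  also have "(\<integral>z. \<Phi> (snd z) (mix UNIV (fst z)) * \<Phi> (snd z) (mix {} (fst z)) \<partial>measure_pmf (map_pmf prod.swap (pair_pmf ?B ?A)))
      = (\<integral>w. \<integral>u. \<Phi> w (mix UNIV u) * \<Phi> w (mix {} u) \<partial>measure_pmf ?A \<partial>measure_pmf ?B)"
    using \<Phi>2 by (simp, subst expectation_pair_pmf) auto
  also have "(\<lambda>w. \<integral>u. \<Phi> w (mix UNIV u) * \<Phi> w (mix {} u) \<partial>measure_pmf ?A)
      = (\<lambda>w. (\<integral>x. \<Phi> w x \<partial>measure_pmf (iid q d (j - 1)))\<^sup>2)"
  proof
    fix w
    have "(\<integral>u. \<Phi> w (mix UNIV u) * \<Phi> w (mix {} u) \<partial>measure_pmf ?A)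
        = (\<integral>z. \<Phi> w (snd z) * \<Phi> w (fst z) \<partial>measure_pmf (pair_pmf (iid q d (j - 1)) (iid q d (j - 1))))"
      by (subst map_pmf_mix_pair[symmetric]) simp
    also have "\<dots> = (\<integral>x. \<integral>y. \<Phi> w y * \<Phi> w x \<partial>measure_pmf (iid q d (j - 1)) \<partial>measure_pmf (iid q d (j - 1)))"
      using \<Phi>2 by (subst expectation_pair_pmf) auto
    finally show "(\<integral>u. \<Phi> w (mix UNIV u) * \<Phi> w (mix {} u) \<partial>measure_pmf ?A)
        = (\<integral>x. \<Phi> w x \<partial>measure_pmf (iid q d (j - 1)))\<^sup>2"
      by (simp add: power2_eq_square)
  qed
  finally show ?thesis .
qed

lemma integral_of_bool_neq_pmf:
  "(\<integral>x. of_bool (x \<noteq> v) \<partial>measure_pmf q) = 1 - pmf q v"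
proof -
  have "(\<lambda>x. of_bool (x \<noteq> v) :: real) = (\<lambda>x. 1 - of_bool (x = v))" by auto
  moreover have "integrable (measure_pmf q) (\<lambda>x. of_bool (x = v) :: real)"
    by (rule integrable_pmf_bounded[where b = 1]) auto
  ultimately show ?thesis by (simp add: integral_of_bool_pmf)
qed

lemma expectation_avoid:
  fixes q :: "'b pmf"
  assumes "finite A"
  shows "(\<integral>x. of_bool (cnt A x v = 0) \<partial>measure_pmf (Pi_pmf A d (\<lambda>_. q))) = (1 - pmf q v) ^ card A"
proof -
  have "(\<lambda>x :: _ \<Rightarrow> 'b. of_bool (cnt A x v = 0) :: real) = (\<lambda>x. \<Prod>k\<in>A. of_bool (x k \<noteq> v))"
    using assms by (auto simp: cnt_def fun_eq_iff)
  moreover have "integrable (measure_pmf q) (\<lambda>x. of_bool (x \<noteq> v) :: real)"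
    by (rule integrable_pmf_bounded[where b = 1]) auto
  ultimately show ?thesis
    using expectation_prod_Pi_pmf[of A "\<lambda>_. q" "\<lambda>_ x. of_bool (x \<noteq> v) :: real" d] assms
    by (simp add: integral_of_bool_neq_pmf)
qed

text \<open>The lower bound is the probability that exactly \<open>r\<close> coordinates equal \<open>a\<close> and none equals \<open>b\<close>.\<close>

lemma expectation_full_and_empty_ge:
  fixes q :: "'b pmf"
  assumes A: "finite A" and ab: "a \<noteq> b"
  shows "real (card A choose r) * (pmf q a ^ r * (1 - pmf q a - pmf q b) ^ (card A - r))
    \<le> (\<integral>x. of_bool (r \<le> cnt A x a \<and> cnt A x b = 0) \<partial>measure_pmf (Pi_pmf A d (\<lambda>_. q)))"
proof -
  let ?P = "Pi_pmf A d (\<lambda>_. q)"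
  let ?\<S> = "{S. S \<subseteq> A \<and> card S = r}"
  \<comment> \<open>The product of \<open>g S k (x k)\<close> indicates that the coordinates in
    \<open>S\<close> equal \<open>a\<close> and all others avoid both \<open>a\<close> and
    \<open>b\<close>; independence factorizes its expectation.\<close>
  define g where "g S k x = (if k \<in> S then of_bool (x = a) else of_bool (x \<noteq> a \<and> x \<noteq> b) :: real)"
    for S :: "nat set" and k x
  have fin: "finite ?\<S>" using A by (auto intro: finite_subset[OF _ finite_Pow_iff[THEN iffD2]])
  have g01: "0 \<le> g S k x" "g S k x \<le> 1" for S k x by (auto simp: g_def)
  have ig: "integrable (measure_pmf q) (g S k)" for S k
    by (rule integrable_pmf_bounded[where b = 1]) (use g01 in auto)
  have Eg: "(\<integral>x. g S k x \<partial>measure_pmf q) = (if k \<in> S then pmf q a else 1 - pmf q a - pmf q b)" for S k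
  proof -
    have i: "integrable (measure_pmf q) (\<lambda>x. of_bool (x = v) :: real)" for v
      by (rule integrable_pmf_bounded[where b = 1]) auto
    have "(\<lambda>x. of_bool (x \<noteq> a \<and> x \<noteq> b) :: real) = (\<lambda>x. 1 - of_bool (x = a) - of_bool (x = b))"
      using ab by auto
    then show ?thesis
      unfolding g_def by (simp add: i integral_of_bool_pmf)
  qed
  have "(\<integral>x. (\<Prod>k\<in>A. g S k (x k)) \<partial>measure_pmf ?P) = pmf q a ^ r * (1 - pmf q a - pmf q b) ^ (card A - r)"
    if S: "S \<in> ?\<S>" for S
  proof -
    have "(\<integral>x. (\<Prod>k\<in>A. g S k (x k)) \<partial>measure_pmf ?P) = (\<Prod>k\<in>A. \<integral>x. g S k x \<partial>measure_pmf q)"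
      by (rule expectation_prod_Pi_pmf) (use A ig g01 in auto)
    also have "\<dots> = (\<Prod>k\<in>S. pmf q a) * (\<Prod>k\<in>A - S. 1 - pmf q a - pmf q b)"
      unfolding Eg using A S by (subst prod.If_cases) (auto simp: Int_absorb1 Diff_eq)
    finally show ?thesis
      using A S by (auto simp: card_Diff_subset finite_subset)
  qed
  then have "real (card A choose r) * (pmf q a ^ r * (1 - pmf q a - pmf q b) ^ (card A - r))
      = (\<Sum>S\<in>?\<S>. \<integral>x. (\<Prod>k\<in>A. g S k (x k)) \<partial>measure_pmf ?P)"
    using n_subsets[OF A, of r] by simp
  also have "\<dots> = (\<integral>x. (\<Sum>S\<in>?\<S>. \<Prod>k\<in>A. g S k (x k)) \<partial>measure_pmf ?P)"
    by (intro Bochner_Integration.integral_sum[symmetric] integrable_prod_Pi_pmf A ig)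
  also have "\<dots> \<le> (\<integral>x. of_bool (r \<le> cnt A x a \<and> cnt A x b = 0) \<partial>measure_pmf ?P)"
  proof (rule integral_mono)
    show "integrable (measure_pmf ?P) (\<lambda>x. \<Sum>S\<in>?\<S>. \<Prod>k\<in>A. g S k (x k))"
      by (intro Bochner_Integration.integrable_sum integrable_prod_Pi_pmf A ig)
    show "integrable (measure_pmf ?P) (\<lambda>x. of_bool (r \<le> cnt A x a \<and> cnt A x b = 0) :: real)"
      by (rule integrable_pmf_bounded[where b = 1]) auto
    fix x :: "nat \<Rightarrow> 'b"
    \<comment> \<open>For a given \<open>x\<close> only \<open>S0\<close>, the set of all positions
      of \<open>a\<close>, can give a nonzero product, so no outcome is counted twice.\<close>
    define S0 where "S0 = {k \<in> A. x k = a}"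
    have le: "(\<Prod>k\<in>A. g S k (x k)) \<le> (if S = S0 then of_bool (r \<le> cnt A x a \<and> cnt A x b = 0) else 0)"
      if S: "S \<in> ?\<S>" for S
    proof (cases "\<exists>k\<in>A. g S k (x k) = 0")
      case True
      then have "(\<Prod>k\<in>A. g S k (x k)) = 0" using A by auto
      then show ?thesis by simp
    next
      case False
      then have "S = S0" "cnt A x b = 0"
        using S ab A by (auto simp: g_def S0_def cnt_def split: if_splits)
      moreover from this have "r \<le> cnt A x a"
        using S by (auto simp: S0_def cnt_def)
      ultimately show ?thesis
        using prod_le_1[of A "\<lambda>k. g S k (x k)"] g01 by simp
    qed
    have "(\<Sum>S\<in>?\<S>. \<Prod>k\<in>A. g S k (x k))
        \<le> (\<Sum>S\<in>?\<S>. if S = S0 then of_bool (r \<le> cnt A x a \<and> cnt A x b = 0) else 0)"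
      by (rule sum_mono) (rule le)
    also have "\<dots> \<le> of_bool (r \<le> cnt A x a \<and> cnt A x b = 0)"
      using fin by simp
    finally show "(\<Sum>S\<in>?\<S>. \<Prod>k\<in>A. g S k (x k)) \<le> of_bool (r \<le> cnt A x a \<and> cnt A x b = 0)" .
  qed
  finally show ?thesis .
qed

text \<open>On the given range \<open>1 \<le> (1 - x) * (1 + 2 * x)\<close>, and
  \<open>1 + 2 * x \<le> exp (2 * x)\<close>.\<close>

lemma exp_le_one_minus_power:
  fixes x :: real
  assumes "0 \<le> x" "x \<le> 1 / 2"
  shows "exp (- (2 * (real k * x))) \<le> (1 - x) ^ k"
proof -
  have "1 \<le> (1 - x) * (1 + 2 * x)"
  proof -
    have "x * (2 * x) \<le> x * 1" using assms by (intro mult_left_mono) auto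
    then show ?thesis by (simp add: algebra_simps)
  qed
  also have "\<dots> \<le> (1 - x) * exp (2 * x)"
    using assms exp_ge_add_one_self[of "2 * x"] by (intro mult_left_mono) auto
  finally have "exp (- (2 * x)) \<le> 1 - x"
    by (simp add: exp_minus field_simps)
  then have "exp (- (2 * x)) ^ k \<le> (1 - x) ^ k"
    by (intro power_mono) auto
  then show ?thesis
    by (simp flip: exp_of_nat_mult add: mult_ac)
qed

text \<open>If at least \<open>r\<close> of the balls \<open>j + 1, \<dots>, n\<close> lie in box \<open>a\<close> and none in box \<open>b\<close>, then
  moving ball \<open>j\<close> from \<open>a\<close> to \<open>b\<close> removes an overflow if no earlier ball lies in \<open>b\<close>. For
  \<open>j \<le> n / 2\<close> this event alone already contributes the right order of magnitude.\<close>

lemma variance_excess_ge: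
  fixes q :: "'b pmf"
  assumes C: "1 \<le> C" "\<And>v. real n * pmf q v \<le> C" and n: "4 * C \<le> real n" "2 * real r \<le> real n"
    and r: "1 \<le> r"
  shows "exp (- (12 * C)) / (16 * (2 * real r) ^ r) * (real n * intensity q r n)
    \<le> measure_pmf.variance (iid q d n) (excess r n)"
proof -
  \<comment> \<open>\<open>p\<close> bounds every box probability; \<open>4 * C \<le> real n\<close>
    makes it at most 1/4, so \<open>p\<close> and \<open>2 * p\<close> both lie in the range of
    \<open>exp_le_one_minus_power\<close>.\<close>
  define p where "p = C / real n"
  have n0: "0 < n" "4 \<le> real n" using n C by linarith+
  have p: "pmf q v \<le> p" "0 \<le> p" "p \<le> 1 / 4" "real n * p = C" for v
    using C n n0 by (auto simp: p_def field_simps)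
  \<comment> \<open>The contribution of one ball relative to the intensity: the squared probability
    that earlier balls avoid \<open>b\<close>, the probability that later balls fill
    \<open>a\<close> and avoid \<open>b\<close>, and 1/2 for \<open>a \<noteq> b\<close>.\<close>
  define \<gamma> where "\<gamma> = exp (- (12 * C)) / (2 * (2 * real r) ^ r)"
  have \<gamma>0: "0 \<le> \<gamma>" by (simp add: \<gamma>_def)
  have low: "(1 - p) ^ k \<ge> exp (- (2 * C))" if "k \<le> n" for k
  proof -
    have "real k * p \<le> C"
      using p(4) mult_right_mono[OF that[folded of_nat_le_iff[where 'a = real]] p(2)] by simp
    moreover have "exp (- (2 * (real k * p))) \<le> (1 - p) ^ k"
      by (rule exp_le_one_minus_power) (use p in auto)
    ultimately show ?thesis
      by (meson exp_le_cancel_iff mult_left_mono neg_le_iff_le order_trans zero_le_numeral)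
  qed
  have low2: "(1 - 2 * p) ^ k \<ge> exp (- (4 * C))" if "k \<le> n" for k
  proof -
    have "real k * p \<le> C"
      using p(4) mult_right_mono[OF that[folded of_nat_le_iff[where 'a = real]] p(2)] by simp
    moreover have "exp (- (2 * (real k * (2 * p)))) \<le> (1 - 2 * p) ^ k"
      by (rule exp_le_one_minus_power) (use p in auto)
    moreover have "exp (- (4 * C)) \<le> exp (- (2 * (real k * (2 * p))))"
      using calculation(1) by simp
    ultimately show ?thesis by linarith
  qed
  let ?e = "\<lambda>j. \<integral>z. step (excess r n) j z * dif (excess r n) j z \<partial>measure_pmf (iid2 q d n)"
  have nonneg: "0 \<le> ?e j" if "j \<in> {1..n}" for j
    unfolding expectation_step_dif[OF that] by (intro integral_nonneg_AE) auto
  have ge: "\<gamma> * intensity q r n \<le> ?e j" if j: "j \<in> {1..n div 2}" for j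
  proof -
    let ?B = "Pi_pmf {j..n} (d, d) (\<lambda>_. pair_pmf q q)"
    let ?B' = "Pi_pmf {Suc j..n} (d, d) (\<lambda>_. pair_pmf q q)"
    have j': "j \<in> {1..n}" using j by auto
    define \<Phi> where "\<Phi> w x = (of_bool (r \<le> cnt {1..<j} x (fst (w j)) + cnt {Suc j..n} (mix {} w) (fst (w j)))
      - of_bool (r \<le> cnt {1..<j} x (snd (w j)) + cnt {Suc j..n} (mix {} w) (snd (w j))) :: real)"
      for w :: "nat \<Rightarrow> 'b \<times> 'b" and x
    define good where "good a b x = (a \<noteq> b \<and> r \<le> cnt {Suc j..n} x a \<and> cnt {Suc j..n} x b = 0)"
      for a b and x :: "nat \<Rightarrow> 'b"
    have \<Phi>1: "\<bar>\<Phi> w x\<bar> \<le> 1" for w x by (simp add: \<Phi>_def)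
    \<comment> \<open>On the good event \<open>\<Phi> w\<close> is at least the indicator that no
      earlier ball lies in \<open>b\<close>: box \<open>a\<close> is already full from later balls,
      and \<open>b\<close> is then empty, hence not full because \<open>1 \<le> r\<close>.\<close>
    have E\<Phi>: "exp (- (4 * C)) * of_bool (good (fst (w j)) (snd (w j)) (mix {} w))
        \<le> (\<integral>x. \<Phi> w x \<partial>measure_pmf (iid q d (j - 1)))\<^sup>2" for w
    proof (cases "good (fst (w j)) (snd (w j)) (mix {} w)")
      case True
      have "exp (- (2 * C)) \<le> (1 - p) ^ (j - 1)"
        using j' by (intro low) auto
      also have "\<dots> \<le> (1 - pmf q (snd (w j))) ^ (j - 1)"
        using p by (intro power_mono) auto
      also have "\<dots> = (\<integral>x. of_bool (cnt {1..j-1} x (snd (w j)) = 0) \<partial>measure_pmf (iid q d (j - 1)))"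
        unfolding iid_def by (subst expectation_avoid) auto
      also have "\<dots> \<le> (\<integral>x. \<Phi> w x \<partial>measure_pmf (iid q d (j - 1)))"
      proof (rule integral_mono)
        show "integrable (measure_pmf (iid q d (j - 1))) (\<lambda>x. of_bool (cnt {1..j-1} x (snd (w j)) = 0) :: real)"
          by (rule integrable_pmf_bounded[where b = 1]) auto
        show "integrable (measure_pmf (iid q d (j - 1))) (\<Phi> w)"
          by (rule integrable_pmf_bounded[where b = 1]) (use \<Phi>1 in simp)
        have "{1..j - 1} = {1..<j}" using j by auto
        then show "of_bool (cnt {1..j-1} x (snd (w j)) = 0) \<le> \<Phi> w x" for x
          using True r by (auto simp: \<Phi>_def good_def)
      qed
      finally have "exp (- (2 * C)) ^ 2 \<le> (\<integral>x. \<Phi> w x \<partial>measure_pmf (iid q d (j - 1)))\<^sup>2"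
        by (intro power_mono) auto
      moreover have "exp (- (2 * C)) ^ 2 = exp (- (4 * C))"
        by (simp flip: exp_of_nat_mult)
      ultimately show ?thesis using True by simp
    qed simp
    have good: "\<bar>(of_bool (good a b x) :: real)\<bar> \<le> 1" for a b x by simp
    have Egood: "exp (- (4 * C)) / (2 * real r) ^ r * (of_bool (a \<noteq> b) * (real n * pmf q a) ^ r)
        \<le> (\<integral>x. of_bool (good a b x) \<partial>measure_pmf (Pi_pmf {Suc j..n} d (\<lambda>_. q)))" for a b
    proof (cases "a = b")
      case False
      \<comment> \<open>Since \<open>j \<le> n div 2\<close>, at least half of the balls come after
        \<open>j\<close>; this produces the factor 2 in \<open>2 * real r\<close>.\<close>
      have rj: "real n / 2 \<le> real (n - j)" "r \<le> n - j"
        using j n by auto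
      have "(real n / (2 * real r)) ^ r \<le> (real (n - j) / real r) ^ r"
        using rj r by (intro power_mono) (auto simp: field_simps)
      also have "\<dots> \<le> real ((n - j) choose r)"
        using binomial_ge_n_over_k_pow_k[of r "n - j", where 'a = real] rj by simp
      finally have ch: "(real n / (2 * real r)) ^ r \<le> real ((n - j) choose r)" .
      have "exp (- (4 * C)) \<le> (1 - 2 * p) ^ (n - j - r)"
        by (rule low2) simp
      also have "\<dots> \<le> (1 - pmf q a - pmf q b) ^ (n - j - r)"
        using p(1)[of a] p(1)[of b] p(3) by (intro power_mono) auto
      finally have pw: "exp (- (4 * C)) \<le> (1 - pmf q a - pmf q b) ^ (n - j - r)" .
      have "exp (- (4 * C)) / (2 * real r) ^ r * (of_bool (a \<noteq> b) * (real n * pmf q a) ^ r)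
          = (real n / (2 * real r)) ^ r * (pmf q a ^ r * exp (- (4 * C)))"
        using False by (simp add: power_divide power_mult_distrib)
      also have "\<dots> \<le> real ((n - j) choose r) * (pmf q a ^ r * (1 - pmf q a - pmf q b) ^ (n - j - r))"
        by (intro mult_mono ch mult_left_mono pw) auto
      also have "\<dots> \<le> (\<integral>x. of_bool (r \<le> cnt {Suc j..n} x a \<and> cnt {Suc j..n} x b = 0)
          \<partial>measure_pmf (Pi_pmf {Suc j..n} d (\<lambda>_. q)))"
        using expectation_full_and_empty_ge[of "{Suc j..n}" a b r q d] False by simp
      finally show ?thesis using False by (simp add: good_def)
    qed (auto intro!: integral_nonneg_AE)
    have "exp (- (4 * C)) * (\<integral>w. of_bool (good (fst (w j)) (snd (w j)) (mix {} w)) \<partial>measure_pmf ?B)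
        \<le> (\<integral>w. (\<integral>x. \<Phi> w x \<partial>measure_pmf (iid q d (j - 1)))\<^sup>2 \<partial>measure_pmf ?B)"
      (is "_ * ?g \<le> _")
    proof -
      have "(\<integral>w. exp (- (4 * C)) * of_bool (good (fst (w j)) (snd (w j)) (mix {} w)) \<partial>measure_pmf ?B)
        \<le> (\<integral>w. (\<integral>x. \<Phi> w x \<partial>measure_pmf (iid q d (j - 1)))\<^sup>2 \<partial>measure_pmf ?B)"
      proof (rule integral_mono)
        show "integrable (measure_pmf ?B) (\<lambda>w. exp (- (4 * C)) * of_bool (good (fst (w j)) (snd (w j)) (mix {} w)))"
          by (intro integrable_mult_right integrable_pmf_bounded[where b = 1]) auto
        have "\<bar>\<integral>x. \<Phi> w x \<partial>measure_pmf (iid q d (j - 1))\<bar> \<le> 1" for w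
          by (rule expectation_pmf_abs_le) (rule \<Phi>1)
        then show "integrable (measure_pmf ?B) (\<lambda>w. (\<integral>x. \<Phi> w x \<partial>measure_pmf (iid q d (j - 1)))\<^sup>2)"
          by (intro integrable_pmf_bounded[where b = 1]) (simp add: abs_square_le_1)
      qed (rule E\<Phi>)
      then show ?thesis by simp
    qed
    also have "\<dots> = ?e j"
      unfolding \<Phi>_def by (rule expectation_step_dif[OF j', symmetric])
    finally have e: "exp (- (4 * C)) * ?g \<le> ?e j" .
    have "?B = Pi_pmf (insert j {Suc j..n}) (d, d) (\<lambda>_. pair_pmf q q)"
    proof -
      have "{j..n} = insert j {Suc j..n}" using j' by auto
      then show ?thesis by simp
    qed
    also have "\<dots> = map_pmf (\<lambda>(y, f). f(j := y)) (pair_pmf (pair_pmf q q) ?B')"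
      by (rule Pi_pmf_insert) auto
    finally have "?g = (\<integral>z. of_bool (good (fst (fst z)) (snd (fst z)) (mix {} (snd z)))
        \<partial>measure_pmf (pair_pmf (pair_pmf q q) ?B'))"
    proof -
      assume B: "?B = map_pmf (\<lambda>(y, f). f(j := y)) (pair_pmf (pair_pmf q q) ?B')"
      have "cnt {Suc j..n} (mix {} (f(j := y))) = cnt {Suc j..n} (mix {} f)" for f and y :: "'b \<times> 'b"
        by (rule cnt_cong) (simp add: mix_def)
      then show ?thesis
        unfolding B by (simp add: case_prod_beta good_def)
    qed
    also have "\<dots> = (\<integral>y. \<integral>f. of_bool (good (fst y) (snd y) (mix {} f)) \<partial>measure_pmf ?B' \<partial>measure_pmf (pair_pmf q q))"
      using good by (subst expectation_pair_pmf) auto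
    also have "\<dots> = (\<integral>y. \<integral>x. of_bool (good (fst y) (snd y) x) \<partial>measure_pmf (Pi_pmf {Suc j..n} d (\<lambda>_. q)) \<partial>measure_pmf (pair_pmf q q))"
    proof -
      have "Pi_pmf {Suc j..n} d (\<lambda>_. map_pmf fst (pair_pmf q q)) = map_pmf (\<lambda>h. fst \<circ> h) ?B'"
        by (rule Pi_pmf_map) auto
      moreover have "mix {} f = fst \<circ> f" for f :: "nat \<Rightarrow> 'b \<times> 'b" by (auto simp: mix_def)
      ultimately show ?thesis by (simp add: map_fst_pair_pmf)
    qed
    also have "\<dots> \<ge> (\<integral>y. exp (- (4 * C)) / (2 * real r) ^ r * (of_bool (fst y \<noteq> snd y) * (real n * pmf q (fst y)) ^ r)
        \<partial>measure_pmf (pair_pmf q q))"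
    proof (rule integral_mono)
      have "\<bar>of_bool (a \<noteq> b) * (real n * pmf q a) ^ r\<bar> \<le> real n ^ r" for a b
        by (simp add: power_mult_distrib abs_mult mult_left_le power_le_one pmf_le_1)
      then show "integrable (measure_pmf (pair_pmf q q))
          (\<lambda>y. exp (- (4 * C)) / (2 * real r) ^ r * (of_bool (fst y \<noteq> snd y) * (real n * pmf q (fst y)) ^ r))"
        by (intro integrable_mult_right integrable_pmf_bounded[where b = "real n ^ r"]) simp
      show "integrable (measure_pmf (pair_pmf q q))
          (\<lambda>y. (\<integral>x. of_bool (good (fst y) (snd y) x) \<partial>measure_pmf (Pi_pmf {Suc j..n} d (\<lambda>_. q))) :: real)"
        by (rule integrable_pmf_bounded[where b = 1], unfold real_norm_def,
            rule expectation_pmf_abs_le, rule good)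
    qed (rule Egood)
    also have "(\<integral>y. exp (- (4 * C)) / (2 * real r) ^ r * (of_bool (fst y \<noteq> snd y) * (real n * pmf q (fst y)) ^ r)
        \<partial>measure_pmf (pair_pmf q q))
      = exp (- (4 * C)) / (2 * real r) ^ r * (\<integral>a. (real n * pmf q a) ^ r * (1 - pmf q a) \<partial>measure_pmf q)"
    proof -
      have bd: "\<bar>of_bool (a \<noteq> b) * (real n * pmf q a) ^ r\<bar> \<le> real n ^ r" for a b
        by (simp add: power_mult_distrib abs_mult mult_left_le power_le_one pmf_le_1)
      have "(\<integral>b. of_bool (a \<noteq> b) \<partial>measure_pmf q) = 1 - pmf q a" for a
      proof -
        have "(\<lambda>b. of_bool (a \<noteq> b) :: real) = (\<lambda>b. of_bool (b \<noteq> a))" by auto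
        then show ?thesis by (simp only: integral_of_bool_neq_pmf)
      qed
      moreover have "(\<integral>y. of_bool (fst y \<noteq> snd y) * (real n * pmf q (fst y)) ^ r \<partial>measure_pmf (pair_pmf q q))
          = (\<integral>a. \<integral>b. of_bool (a \<noteq> b) * (real n * pmf q a) ^ r \<partial>measure_pmf q \<partial>measure_pmf q)"
        by (subst expectation_pair_pmf[where b = "real n ^ r"]) (use bd in simp_all)
      ultimately show ?thesis
        by (simp add: mult.commute)
    qed
    finally have g: "exp (- (4 * C)) / (2 * real r) ^ r * (\<integral>a. (real n * pmf q a) ^ r * (1 - pmf q a) \<partial>measure_pmf q) \<le> ?g" .
    have "intensity q r n / 2 \<le> (\<integral>a. (real n * pmf q a) ^ r * (1 - pmf q a) \<partial>measure_pmf q)"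
    proof -
      have "(\<integral>a. (real n * pmf q a) ^ r / 2 \<partial>measure_pmf q)
          \<le> (\<integral>a. (real n * pmf q a) ^ r * (1 - pmf q a) \<partial>measure_pmf q)"
      proof (rule integral_mono)
        show "integrable (measure_pmf q) (\<lambda>a. (real n * pmf q a) ^ r / 2)"
          by (intro integrable_divide intensity_integrable)
        show "integrable (measure_pmf q) (\<lambda>a. (real n * pmf q a) ^ r * (1 - pmf q a))"
          by (rule integrable_pmf_bounded[where b = "real n ^ r * 1"], rule norm_mult_bounded)
            (simp_all add: power_mult_distrib mult_left_le power_le_one pmf_le_1)
        have "1 / 2 \<le> 1 - pmf q a" for a
          using p(1)[of a] p(3) by linarith
        then have "(real n * pmf q a) ^ r * (1 / 2) \<le> (real n * pmf q a) ^ r * (1 - pmf q a)" for a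
          by (intro mult_left_mono) auto
        then show "(real n * pmf q a) ^ r / 2 \<le> (real n * pmf q a) ^ r * (1 - pmf q a)" for a
          by simp
      qed
      then show ?thesis by (simp add: intensity_def)
    qed
    then have "exp (- (4 * C)) / (2 * real r) ^ r * (intensity q r n / 2) \<le> ?g"
      by (intro order_trans[OF mult_left_mono g]) auto
    then have "exp (- (4 * C)) * (exp (- (4 * C)) / (2 * real r) ^ r * (intensity q r n / 2)) \<le> ?e j"
      by (intro order_trans[OF mult_left_mono e]) auto
    moreover have "\<gamma> * intensity q r n
        \<le> exp (- (4 * C)) * (exp (- (4 * C)) / (2 * real r) ^ r * (intensity q r n / 2))"
    proof -
      \<comment> \<open>The two factors multiply to \<open>exp (- (8 * C))\<close>; the exponent in
        \<open>\<gamma>\<close> is a weaker bound.\<close>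
      have "exp (- (12 * C)) \<le> exp (- (4 * C)) * exp (- (4 * C))"
        using C by (simp flip: exp_add)
      then have "exp (- (12 * C)) * (intensity q r n / (2 * (2 * real r) ^ r))
          \<le> exp (- (4 * C)) * exp (- (4 * C)) * (intensity q r n / (2 * (2 * real r) ^ r))"
        by (intro mult_right_mono) (auto simp: intensity_nonneg)
      then show ?thesis by (simp add: \<gamma>_def)
    qed
    ultimately show ?thesis by linarith
  qed
  \<comment> \<open>Rounding in \<open>n div 2\<close> is absorbed by passing from
    \<open>n / 2\<close> to \<open>n / 4\<close>.\<close>
  have "\<gamma> * intensity q r n * (real n / 4) \<le> real (n div 2) * (\<gamma> * intensity q r n)"
  proof -
    have "real n / 4 \<le> real (n div 2)"
      using n0 by (cases "even n") (auto elim!: evenE oddE)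
    then show ?thesis
      using \<gamma>0 intensity_nonneg[of q r n] by (subst mult.commute) (intro mult_right_mono, auto)
  qed
  also have "\<dots> = (\<Sum>j=1..n div 2. \<gamma> * intensity q r n)"
    by simp
  also have "\<dots> \<le> (\<Sum>j=1..n div 2. ?e j)"
    by (rule sum_mono) (rule ge)
  also have "\<dots> \<le> (\<Sum>j=1..n. ?e j)"
    by (rule sum_mono2) (use nonneg in auto)
  also have "\<dots> = 2 * measure_pmf.variance (iid q d n) (excess r n)"
    unfolding variance_formula[OF excess_bound] by simp
  finally have "\<gamma> * intensity q r n * (real n / 4) \<le> 2 * measure_pmf.variance (iid q d n) (excess r n)" .
  moreover have "exp (- (12 * C)) / (16 * (2 * real r) ^ r) * (real n * intensity q r n)
      = \<gamma> * intensity q r n * (real n / 4) / 2"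
    by (simp add: \<gamma>_def mult_ac)
  ultimately show ?thesis by linarith
qed

subsection \<open>Central limit theorem\<close>

text \<open>This is the nonnegativity of the variance of the absolute deviation.\<close>

lemma abs_deviation_le_sqrt_variance:
  fixes h :: "'a \<Rightarrow> real"
  assumes h: "\<And>x. \<bar>h x\<bar> \<le> b"
  shows "(\<integral>x. \<bar>h x - (\<integral>x. h x \<partial>measure_pmf M)\<bar> \<partial>measure_pmf M) \<le> sqrt (measure_pmf.variance M h)"
proof -
  let ?w = "\<lambda>x. \<bar>h x - (\<integral>x. h x \<partial>measure_pmf M)\<bar>"
  have w: "norm (?w x) \<le> 2 * b" for x
    using h[of x] expectation_pmf_abs_le[of h b M, OF h] by simp
  have "integrable (measure_pmf M) ?w"
    by (rule integrable_pmf_bounded) (rule w)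
  moreover have "integrable (measure_pmf M) (\<lambda>x. (?w x)\<^sup>2)"
    unfolding power2_eq_square by (rule integrable_pmf_bounded) (rule norm_mult_bounded[OF w w])
  ultimately have "measure_pmf.variance M ?w = measure_pmf.variance M h - (measure_pmf.expectation M ?w)\<^sup>2"
    by (subst measure_pmf.variance_eq) simp_all
  then have "(measure_pmf.expectation M ?w)\<^sup>2 \<le> measure_pmf.variance M h"
    using measure_pmf.variance_positive[of M ?w] by linarith
  then show ?thesis
    by (rule real_le_rsqrt)
qed

text \<open>\<open>stein_char_bound\<close> is used at \<open>u = t / sqrt v\<close> with
  \<open>\<tau>\<close> of order \<open>sqrt \<mu>\<close> and \<open>\<beta>\<close> of order
  \<open>\<mu>\<close>. Since \<open>v\<close> is at least \<open>c * \<mu>\<close>, both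
  \<open>u\<^sup>2 * \<tau>\<close> and \<open>\<bar>u\<bar> ^ 3 * \<beta>\<close> are of order
  \<open>1 / sqrt \<mu>\<close>.\<close>

lemma excess_char_bound:
  fixes q :: "'b pmf" and d :: 'b and n r :: nat
  assumes C: "1 \<le> C" "\<And>v. real n * pmf q v \<le> C" and n: "4 * C \<le> real n" "2 * real r \<le> real n"
    and r: "1 \<le> r"
  defines "\<mu> \<equiv> real n * intensity q r n"
    and "m \<equiv> \<integral>x. excess r n x \<partial>measure_pmf (iid q d n)"
    and "v \<equiv> measure_pmf.variance (iid q d n) (excess r n)"
    and "K \<equiv> exp (4 * C)" and "c \<equiv> exp (- (12 * C)) / (16 * (2 * real r) ^ r)"
  assumes \<mu>: "0 < \<mu>"
  shows "norm ((\<integral>x. iexp (t * ((excess r n x - m) / sqrt v)) \<partial>measure_pmf (iid q d n)) - of_real (exp (- (t\<^sup>2 / 2))))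
    \<le> (t\<^sup>2 * (sqrt (32 * K) / c) + \<bar>t\<bar> ^ 3 * (K / (2 * (c * sqrt c)))) / sqrt \<mu>"
proof -
  let ?f = "excess r n :: (nat \<Rightarrow> 'b) \<Rightarrow> real"
  have c: "0 < c" using r by (simp add: c_def)
  have cv: "c * \<mu> \<le> v"
    unfolding c_def \<mu>_def v_def by (rule variance_excess_ge[OF C n r])
  have v: "0 < v"
    using cv c \<mu> mult_pos_pos[of c \<mu>] by linarith
  have K: "0 < K" by (simp add: K_def)
  define u where "u = t / sqrt v"
  have dev: "(\<integral>z. \<bar>stein ?f n z - v\<bar> \<partial>measure_pmf (iid2 q d n)) \<le> sqrt (32 * K * \<mu>)"
  proof -
    have T: "\<bar>stein ?f n z\<bar> \<le> real n * ((2 * real n) * (2 * real n))" for z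
      by (rule stein_bound) (rule excess_bound)
    have "(\<integral>z. stein ?f n z \<partial>measure_pmf (iid2 q d n)) = v"
      unfolding v_def by (rule expectation_stein) (rule excess_bound)
    then have "(\<integral>z. \<bar>stein ?f n z - v\<bar> \<partial>measure_pmf (iid2 q d n))
        \<le> sqrt (measure_pmf.variance (iid2 q d n) (stein ?f n))"
      using abs_deviation_le_sqrt_variance[of "stein ?f n", OF T, of "iid2 q d n"] by simp
    also have "\<dots> \<le> sqrt (32 * K * \<mu>)"
      unfolding K_def \<mu>_def by (intro real_sqrt_le_mono variance_stein_le C)
    finally show ?thesis .
  qed
  have third: "(\<Sum>j=1..n. \<integral>z. \<bar>step ?f j z\<bar> * (dif ?f j z)\<^sup>2 \<partial>measure_pmf (iid2 q d n)) \<le> 2 * K * \<mu>"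
  proof -
    have "(\<integral>z. \<bar>step ?f j z\<bar> * (dif ?f j z)\<^sup>2 \<partial>measure_pmf (iid2 q d n)) \<le> 2 * K * intensity q r n"
      if j: "j \<in> {1..n}" for j
    proof -
      \<comment> \<open>Both differences are at most 1 in absolute value, so the third-order term
        reduces to a first absolute moment.\<close>
      have le: "\<bar>step ?f j z\<bar> * (dif ?f j z)\<^sup>2 \<le> \<bar>dif ?f j z\<bar>" for z
      proof -
        have "\<bar>step ?f j z\<bar> * (\<bar>dif ?f j z\<bar> * \<bar>dif ?f j z\<bar>) \<le> 1 * (1 * \<bar>dif ?f j z\<bar>)"
          by (intro mult_mono step_excess_le_1 dif_excess_le_1 j) auto
        then show ?thesis by (simp add: power2_eq_square)
      qed
      have "(\<integral>z. \<bar>step ?f j z\<bar> * (dif ?f j z)\<^sup>2 \<partial>measure_pmf (iid2 q d n))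
          \<le> (\<integral>z. \<bar>dif ?f j z\<bar> \<partial>measure_pmf (iid2 q d n))"
      proof (rule integral_mono)
        have "norm (\<bar>step ?f j z\<bar> * (dif ?f j z)\<^sup>2) \<le> 1" for z
          using order_trans[OF le dif_excess_le_1[OF j]] by simp
        then show "integrable (measure_pmf (iid2 q d n)) (\<lambda>z. \<bar>step ?f j z\<bar> * (dif ?f j z)\<^sup>2)"
          by (rule integrable_pmf_bounded)
        show "integrable (measure_pmf (iid2 q d n)) (\<lambda>z. \<bar>dif ?f j z\<bar>)"
          by (rule integrable_pmf_bounded[where b = 1]) (use dif_excess_le_1[OF j] in simp)
      qed (rule le)
      also have "\<dots> \<le> 2 * K * intensity q r n"
        unfolding K_def by (rule expectation_abs_dif_excess[OF j C])
      finally show ?thesis .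
    qed
    then have "(\<Sum>j=1..n. \<integral>z. \<bar>step ?f j z\<bar> * (dif ?f j z)\<^sup>2 \<partial>measure_pmf (iid2 q d n))
        \<le> (\<Sum>j=1..n. 2 * K * intensity q r n)"
      by (rule sum_mono)
    then show ?thesis by (simp add: \<mu>_def mult_ac)
  qed
  have main: "norm ((\<integral>x. iexp (u * (?f x - m)) \<partial>measure_pmf (iid q d n)) - of_real (exp (- (u\<^sup>2 * v / 2))))
      \<le> u\<^sup>2 * sqrt (32 * K * \<mu>) + \<bar>u\<bar> ^ 3 * (2 * K * \<mu> / 4)"
    unfolding m_def v_def
    by (rule stein_char_bound[OF excess_bound dev[unfolded v_def] third])
  have uv: "u\<^sup>2 * v = t\<^sup>2"
    using v by (simp add: u_def power_divide)
  have ux: "u * (?f x - m) = t * ((?f x - m) / sqrt v)" for x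
    by (simp add: u_def)
  have b1: "u\<^sup>2 * sqrt (32 * K * \<mu>) \<le> t\<^sup>2 * (sqrt (32 * K) / c) / sqrt \<mu>"
  proof -
    have "u\<^sup>2 \<le> t\<^sup>2 / (c * \<mu>)"
      using v cv c \<mu> by (auto simp: u_def power_divide intro!: divide_left_mono)
    then have "u\<^sup>2 * sqrt (32 * K * \<mu>) \<le> t\<^sup>2 / (c * \<mu>) * sqrt (32 * K * \<mu>)"
      using K \<mu> by (intro mult_right_mono) auto
    also have "\<dots> = t\<^sup>2 * (sqrt (32 * K) / c) * (sqrt \<mu> / \<mu>)"
      by (simp add: real_sqrt_mult)
    also have "sqrt \<mu> / \<mu> = 1 / sqrt \<mu>"
      using \<mu> by (simp add: real_div_sqrt field_simps)
    finally show ?thesis by simp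
  qed
  have b2: "\<bar>u\<bar> ^ 3 * (2 * K * \<mu> / 4) \<le> \<bar>t\<bar> ^ 3 * (K / (2 * (c * sqrt c))) / sqrt \<mu>"
  proof -
    have "\<bar>u\<bar> \<le> \<bar>t\<bar> / sqrt (c * \<mu>)"
      using v cv c \<mu> by (auto simp: u_def intro!: divide_left_mono)
    then have "\<bar>u\<bar> ^ 3 * (2 * K * \<mu> / 4) \<le> (\<bar>t\<bar> / sqrt (c * \<mu>)) ^ 3 * (2 * K * \<mu> / 4)"
      using K \<mu> by (intro mult_right_mono power_mono) auto
    also have "\<dots> = \<bar>t\<bar> ^ 3 * (K / 2) * (\<mu> / (sqrt (c * \<mu>)) ^ 3)"
      by (simp add: power_divide)
    also have "\<mu> / (sqrt (c * \<mu>)) ^ 3 = 1 / (c * sqrt c) / sqrt \<mu>"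
    proof -
      have "(sqrt (c * \<mu>)) ^ 3 = (sqrt (c * \<mu>))\<^sup>2 * sqrt (c * \<mu>)"
        by (simp add: power3_eq_cube power2_eq_square)
      also have "\<dots> = (c * \<mu>) * (sqrt c * sqrt \<mu>)"
        using c \<mu> by (simp add: real_sqrt_mult power_mult_distrib)
      finally show ?thesis
        using c \<mu> by simp
    qed
    finally show ?thesis by simp
  qed
  show ?thesis
    using order_trans[OF main add_mono[OF b1 b2]] unfolding uv ux add_divide_distrib .
qed

section \<open>Transfer from the given probability spaces to mass functions\<close>

lemma exists_pmf_of_nat_measure:
  fixes M :: "nat measure"
  assumes M: "prob_space M" "sets M = UNIV"
  shows "\<exists>q. measure_pmf q = M"
proof -
  interpret prob_space M by fact
  \<comment> \<open>There are countably many points, so the null singletons together form a null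
    set.\<close>
  have "AE x in M. \<forall>m. x = m \<longrightarrow> measure M {m} \<noteq> 0"
    unfolding AE_all_countable
  proof
    fix m
    show "AE x in M. x = m \<longrightarrow> measure M {m} \<noteq> 0"
    proof (cases "measure M {m} = 0")
      case True
      then have "emeasure M {m} = 0" by (simp add: emeasure_eq_measure)
      then show ?thesis
        by (intro AE_I[where N = "{m}"]) (auto simp: M)
    qed simp
  qed
  then have "AE x in M. measure M {x} \<noteq> 0" by simp
  then have "measure_pmf (Abs_pmf M) = M"
    using M by (intro Abs_pmf_inverse) auto
  then show ?thesis by blast
qed

text \<open>Coordinates outside \<open>{1..n}\<close> get the default value that \<open>Pi_pmf\<close> requires.\<close>

definition row :: "nat \<Rightarrow> (nat \<Rightarrow> 'a \<Rightarrow> nat) \<Rightarrow> 'a \<Rightarrow> nat \<Rightarrow> nat" where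
  "row n X \<omega> i = (if i \<in> {1..n} then X i \<omega> else 0)"

text \<open>Rows live in a countable set of functions, so the law is determined by its point masses,
  and independence makes these products of the masses of \<open>q\<close>.\<close>

lemma row_law:
  fixes P :: "'a measure" and X :: "nat \<Rightarrow> 'a \<Rightarrow> nat" and n r :: nat
  assumes P: "prob_space P" and n: "1 \<le> n"
    and indep: "prob_space.indep_vars P (\<lambda>_. count_space B) X {1..n}"
    and ident: "\<And>j. j \<in> {1..n} \<Longrightarrow>
      distr P (count_space B) (X j) = distr P (count_space B) (X 1)"
  shows "\<exists>q. distr P (count_space UNIV) (X 1) = measure_pmf q \<and>
    row n X \<in> measurable P (count_space UNIV) \<and>
    distr P (count_space UNIV) (row n X) = measure_pmf (iid q 0 n)"
proof -
  interpret prob_space P by fact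
  have XB: "X j \<in> measurable P (count_space B)" if "j \<in> {1..n}" for j
    using indep that by (simp add: indep_vars_def2)
  have X: "X j \<in> measurable P (count_space UNIV)" if "j \<in> {1..n}" for j
    using measurable_compose[OF XB[OF that], of "\<lambda>x. x" "count_space UNIV"] by simp
  have "prob_space (distr P (count_space UNIV) (X 1))"
    by (rule prob_space_distr) (use X n in auto)
  from exists_pmf_of_nat_measure[OF this] obtain q where
    q: "measure_pmf q = distr P (count_space UNIV) (X 1)" by auto
  \<comment> \<open>Independence and equality of laws are given over \<open>count_space B\<close>,
    whose events are subsets of \<open>B\<close>; intersecting with \<open>B\<close> changes no
    preimage.\<close>
  have pq: "prob (X j -` ({v} \<inter> B) \<inter> space P) = pmf q v" if j: "j \<in> {1..n}" for j v
  proof -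
    have B: "{v} \<inter> B \<in> sets (count_space B)" by simp
    have "prob (X j -` ({v} \<inter> B) \<inter> space P) = measure (distr P (count_space B) (X j)) ({v} \<inter> B)"
      using B XB[OF j] by (simp add: measure_distr)
    also have "\<dots> = measure (distr P (count_space B) (X 1)) ({v} \<inter> B)"
      by (simp only: ident[OF j])
    also have "\<dots> = prob (X 1 -` ({v} \<inter> B) \<inter> space P)"
      using B XB[of 1] n by (simp add: measure_distr)
    also have "X 1 -` ({v} \<inter> B) \<inter> space P = X 1 -` {v} \<inter> space P"
      using measurable_space[OF XB[of 1]] n by auto
    also have "prob \<dots> = pmf q v"
      using X[of 1] n by (simp add: measure_distr pmf.rep_eq q)
    finally show ?thesis .
  qed
  \<comment> \<open>The space of all functions is uncountable; with the default value fixed outside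
    \<open>{1..n}\<close> the rows form a countable set, where checking singletons suffices.\<close>
  let ?\<Omega> = "{f :: nat \<Rightarrow> nat. \<forall>x. x \<notin> {1..n} \<longrightarrow> f x = 0}"
  have cnt: "countable ?\<Omega>"
  proof -
    have "?\<Omega> = PiE_dflt {1..n} 0 (\<lambda>_. UNIV)" by (auto simp: PiE_dflt_def)
    also have "\<dots> = (\<lambda>h x. if x \<in> {1..n} then h x else 0) ` PiE {1..n} (\<lambda>_. UNIV)"
      by (rule dflt_image_PiE[symmetric])
    also have "countable \<dots>"
      by (intro countable_image countable_PiE) auto
    finally show ?thesis .
  qed
  have row_eq: "row n X -` {x} \<inter> space P = (\<Inter>i\<in>{1..n}. X i -` ({x i} \<inter> B) \<inter> space P)" if "x \<in> ?\<Omega>" for x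
  proof -
    have "X i \<omega> \<in> B" if "i \<in> {1..n}" "\<omega> \<in> space P" for i \<omega>
      using measurable_space[OF XB[OF that(1)] that(2)] by simp
    then show ?thesis
      using that n by (auto simp: row_def fun_eq_iff)
  qed
  have "row n X \<in> measurable P (count_space ?\<Omega>)"
    unfolding measurable_count_space_eq_countable[OF cnt]
  proof (intro conjI ballI)
    show "row n X \<in> space P \<rightarrow> ?\<Omega>"
      by (auto simp: row_def)
    fix f assume f: "f \<in> ?\<Omega>"
    have "(\<Inter>i\<in>{1..n}. X i -` ({f i} \<inter> B) \<inter> space P) \<in> sets P"
      by (intro sets.finite_INT measurable_sets[OF XB]) (use n in auto)
    then show "row n X -` {f} \<inter> space P \<in> sets P"
      using row_eq[OF f] by simp
  qed
  from measurable_compose[OF this, of "\<lambda>x. x" "count_space UNIV"]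
  have row: "row n X \<in> measurable P (count_space UNIV)" by simp
  have "distr P (count_space UNIV) (row n X) = measure_pmf (iid q 0 n)"
  proof (rule measure_eqI_countable_AE)
    show "AE x in distr P (count_space UNIV) (row n X). x \<in> ?\<Omega>"
      by (subst AE_distr_iff[OF row]) (auto simp: row_def)
    show "AE x in measure_pmf (iid q 0 n). x \<in> ?\<Omega>"
      by (rule AE_pmfI) (use iid_outside in fastforce)
    fix x assume x: "x \<in> ?\<Omega>"
    have "emeasure (distr P (count_space UNIV) (row n X)) {x} = emeasure P (row n X -` {x} \<inter> space P)"
      by (rule emeasure_distr[OF row]) simp
    also have "\<dots> = prob (\<Inter>i\<in>{1..n}. X i -` ({x i} \<inter> B) \<inter> space P)"
      by (simp only: row_eq[OF x] emeasure_eq_measure)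
    also have "prob (\<Inter>i\<in>{1..n}. X i -` ({x i} \<inter> B) \<inter> space P) = (\<Prod>i\<in>{1..n}. prob (X i -` ({x i} \<inter> B) \<inter> space P))"
      by (rule indep_varsD_finite[OF indep]) (use n in auto)
    also have "\<dots> = (\<Prod>i\<in>{1..n}. pmf q (x i))"
      by (rule prod.cong[OF refl pq])
    also have "\<dots> = pmf (iid q 0 n) x"
      unfolding iid_def using x by (subst pmf_Pi') auto
    also have "ennreal \<dots> = emeasure (measure_pmf (iid q 0 n)) {x}"
      by (simp add: emeasure_pmf_single)
    finally show "emeasure (distr P (count_space UNIV) (row n X)) {x} = emeasure (measure_pmf (iid q 0 n)) {x}" .
  qed (use cnt in auto)
  with q row show ?thesis by metis
qed

lemma overflow_eq_excess:
  assumes "\<And>j. j \<in> {1..n} \<Longrightarrow> X j \<omega> \<in> B"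
  shows "overflow B X n r \<omega> = excess r n (row n X \<omega>)"
  unfolding overflow_def excess_def
proof (rule sum.cong[OF refl])
  fix k assume k: "k \<in> {1..n}"
  have "ball_count X k (X k \<omega>) \<omega> = cnt {1..<k} (row n X \<omega>) (row n X \<omega> k)"
    using k by (auto simp: ball_count_def cnt_def row_def Int_def intro!: arg_cong[where f = card])
  then show "ball_overflow B X r k \<omega> = of_bool (r \<le> cnt {1..<k} (row n X \<omega>) (row n X \<omega> k))"
    using ball_overflow_eq[of X k \<omega> B r] assms k by simp
qed

lemma standardized_overflow:
  fixes P :: "'a measure" and X :: "nat \<Rightarrow> 'a \<Rightarrow> nat" and n r :: nat
  assumes P: "prob_space P"
    and X: "\<And>j \<omega>. j \<in> {1..n} \<Longrightarrow> \<omega> \<in> space P \<Longrightarrow> X j \<omega> \<in> B"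
    and row: "row n X \<in> measurable P (count_space UNIV)"
    and law: "distr P (count_space UNIV) (row n X) = measure_pmf Q"
  defines "Z \<equiv> \<lambda>\<omega>. (overflow B X n r \<omega> - prob_space.expectation P (overflow B X n r))
      / sqrt (prob_space.variance P (overflow B X n r))"
  shows "Z \<in> borel_measurable P"
    and "char (distr P borel Z) t = (\<integral>x. iexp (t * ((excess r n x - (\<integral>x. excess r n x \<partial>measure_pmf Q))
      / sqrt (measure_pmf.variance Q (excess r n)))) \<partial>measure_pmf Q)"
proof -
  have eq: "overflow B X n r \<omega> = excess r n (row n X \<omega>)" if "\<omega> \<in> space P" for \<omega>
    by (rule overflow_eq_excess) (rule X[OF _ that])
  \<comment> \<open>An arbitrary \<open>h\<close> with general codomain lets one change of variables
    serve the mean, the variance and the complex exponential.\<close>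
  have E: "(\<integral>\<omega>. h (overflow B X n r \<omega>) \<partial>P) = (\<integral>x. h (excess r n x) \<partial>measure_pmf Q)"
    for h :: "real \<Rightarrow> 'c::{banach, second_countable_topology}"
  proof -
    have "(\<integral>\<omega>. h (overflow B X n r \<omega>) \<partial>P) = (\<integral>\<omega>. h (excess r n (row n X \<omega>)) \<partial>P)"
      by (rule Bochner_Integration.integral_cong) (simp_all add: eq)
    also have "\<dots> = (\<integral>x. h (excess r n x) \<partial>distr P (count_space UNIV) (row n X))"
      by (rule integral_distr[symmetric, OF row]) simp
    finally show ?thesis by (simp only: law)
  qed
  define m where "m = (\<integral>x. excess r n x \<partial>measure_pmf Q)"
  define v where "v = measure_pmf.variance Q (excess r n)"
  have Z: "Z = (\<lambda>\<omega>. (overflow B X n r \<omega> - m) / sqrt v)"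
  proof -
    have "prob_space.expectation P (overflow B X n r) = m"
      unfolding m_def by (rule E)
    then show ?thesis
      unfolding Z_def v_def using E[of "\<lambda>y. (y - m)\<^sup>2"] by (simp add: m_def)
  qed
  have "(\<lambda>\<omega>. (excess r n (row n X \<omega>) - m) / sqrt v) \<in> borel_measurable P"
    by (rule measurable_compose[OF row]) simp
  then show meas: "Z \<in> borel_measurable P"
    unfolding Z by (subst measurable_cong[of P _ "\<lambda>\<omega>. (excess r n (row n X \<omega>) - m) / sqrt v"]) (auto simp: eq)
  have "char (distr P borel Z) t = (\<integral>\<omega>. iexp (t * Z \<omega>) \<partial>P)"
    unfolding char_def by (rule integral_distr[OF meas]) simp
  also have "\<dots> = (\<integral>x. iexp (t * ((excess r n x - m) / sqrt v)) \<partial>measure_pmf Q)"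
    unfolding Z by (rule E)
  finally show "char (distr P borel Z) t = (\<integral>x. iexp (t * ((excess r n x - (\<integral>x. excess r n x \<partial>measure_pmf Q))
      / sqrt (measure_pmf.variance Q (excess r n)))) \<partial>measure_pmf Q)"
    by (simp only: m_def v_def)
qed

theorem theorem4p1:
  fixes P :: "nat \<Rightarrow> 'a measure"
    and B :: "nat \<Rightarrow> nat set"
    and X :: "nat \<Rightarrow> nat \<Rightarrow> 'a \<Rightarrow> nat"
    and r :: nat
    and lam :: real
  assumes prob: "\<And>n. n \<ge> 1 \<Longrightarrow> prob_space (P n)"
    and boxes: "\<And>n. n \<ge> 1 \<Longrightarrow> B n \<subseteq> {1..}"
    and indep: "\<And>n. n \<ge> 1 \<Longrightarrow>
      prob_space.indep_vars (P n) (\<lambda>_. count_space (B n)) (X n) {1..n}"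
    and ident: "\<And>n j. n \<ge> 1 \<Longrightarrow> j \<in> {1..n} \<Longrightarrow>
      distr (P n) (count_space (B n)) (X n j) = distr (P n) (count_space (B n)) (X n 1)"
    and r: "r \<ge> 1"
    and lam: "lam \<ge> 0"
    and lim_max: "(\<lambda>n. real n * max_box_prob (P n) (B n) (X n)) \<longlonglongrightarrow> lam"
    and lim_moment:
      "filterlim (\<lambda>n. real n ^ (r + 1) * box_prob_moment (P n) (X n) r) at_top sequentially"
  shows "weak_conv_m
    (\<lambda>n. distr (P n) borel
      (\<lambda>\<omega>. (overflow (B n) (X n) n r \<omega> - prob_space.expectation (P n) (overflow (B n) (X n) n r))
            / sqrt (prob_space.variance (P n) (overflow (B n) (X n) n r))))
    std_normal_distribution"
proof -
  define Z where "Z n = (\<lambda>\<omega>. (overflow (B n) (X n) n r \<omega> - prob_space.expectation (P n) (overflow (B n) (X n) n r))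
    / sqrt (prob_space.variance (P n) (overflow (B n) (X n) n r)))" for n
  have "\<exists>q. n \<ge> 1 \<longrightarrow> distr (P n) (count_space UNIV) (X n 1) = measure_pmf q \<and>
    row n (X n) \<in> measurable (P n) (count_space UNIV) \<and>
    distr (P n) (count_space UNIV) (row n (X n)) = measure_pmf (iid q 0 n)" for n
    using row_law[OF prob _ indep ident, of n] by blast
  then obtain q where q: "\<And>n. n \<ge> 1 \<Longrightarrow> distr (P n) (count_space UNIV) (X n 1) = measure_pmf (q n)"
    and row: "\<And>n. n \<ge> 1 \<Longrightarrow> row n (X n) \<in> measurable (P n) (count_space UNIV)"
    and law: "\<And>n. n \<ge> 1 \<Longrightarrow> distr (P n) (count_space UNIV) (row n (X n)) = measure_pmf (iid (q n) 0 n)"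
    by metis
  have XB: "X n j \<omega> \<in> B n" if "n \<ge> 1" "j \<in> {1..n}" "\<omega> \<in> space (P n)" for n j \<omega>
  proof -
    have "X n j \<in> measurable (P n) (count_space (B n))"
      using indep[OF that(1)] that(2) by (simp add: prob_space.indep_vars_def2[OF prob[OF that(1)]])
    from measurable_space[OF this that(3)] show ?thesis by simp
  qed
  have X1: "X n 1 \<in> measurable (P n) (count_space UNIV)" if "n \<ge> 1" for n
  proof -
    have "X n 1 \<in> measurable (P n) (count_space (B n))"
      using indep[OF that] that by (simp add: prob_space.indep_vars_def2[OF prob[OF that]])
    from measurable_compose[OF this, of "\<lambda>x. x" "count_space UNIV"] show ?thesis by simp
  qed
  have bp: "box_prob (P n) (X n) m = pmf (q n) m" if n: "n \<ge> 1" for n m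
  proof -
    have "pmf (q n) m = measure (distr (P n) (count_space UNIV) (X n 1)) {m}"
      by (simp only: q[OF n] pmf.rep_eq)
    also have "\<dots> = measure (P n) (X n 1 -` {m} \<inter> space (P n))"
      by (rule measure_distr[OF X1[OF n]]) simp
    also have "X n 1 -` {m} \<inter> space (P n) = {\<omega> \<in> space (P n). X n 1 \<omega> = m}"
      by auto
    finally show ?thesis by (simp add: box_prob_def)
  qed
  have le_max: "pmf (q n) m \<le> max_box_prob (P n) (B n) (X n)" if n: "n \<ge> 1" for n m
  proof -
    have bdd: "bdd_above (box_prob (P n) (X n) ` B n)"
      by (rule bdd_aboveI2[where M = 1]) (simp add: bp[OF n] pmf_le_1)
    have mem: "pmf (q n) k \<le> max_box_prob (P n) (B n) (X n)" if "k \<in> B n" for k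
      using cSUP_upper[OF that bdd] by (simp add: max_box_prob_def bp[OF n])
    interpret prob_space "P n" by (rule prob[OF n])
    \<comment> \<open>A sample point shows that \<open>B n\<close> is nonempty, so the supremum is
      nonnegative and also dominates the zero mass outside \<open>B n\<close>.\<close>
    obtain \<omega> where "\<omega> \<in> space (P n)" using not_empty by blast
    then have k: "X n 1 \<omega> \<in> B n" using n by (intro XB) auto
    show ?thesis
    proof (cases "m \<in> B n")
      case False
      then have "{\<omega> \<in> space (P n). X n 1 \<omega> = m} = {}"
        using XB[OF n, of 1] n by auto
      then have "pmf (q n) m = 0"
        unfolding bp[OF n, symmetric] box_prob_def by (simp only: measure_empty)
      then show ?thesis
        using mem[OF k] pmf_nonneg[of "q n" "X n 1 \<omega>"] by linarith
    qed (rule mem)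
  qed
  have moment: "real n ^ (r + 1) * box_prob_moment (P n) (X n) r = real n * intensity (q n) r n"
    if n: "n \<ge> 1" for n
  proof -
    have "box_prob_moment (P n) (X n) r = (\<integral>\<omega>. pmf (q n) (X n 1 \<omega>) ^ r \<partial>P n)"
      unfolding box_prob_moment_def bp[OF n] ..
    also have "\<dots> = (\<integral>v. pmf (q n) v ^ r \<partial>distr (P n) (count_space UNIV) (X n 1))"
      by (rule integral_distr[symmetric, OF X1[OF n]]) simp
    also have "\<dots> = (\<integral>v. pmf (q n) v ^ r \<partial>measure_pmf (q n))"
      by (simp only: q[OF n])
    finally show ?thesis
      by (simp add: intensity_def power_mult_distrib)
  qed
  obtain C where C: "1 \<le> C" "\<And>n m. n \<ge> 1 \<Longrightarrow> real n * pmf (q n) m \<le> C"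
  proof -
    \<comment> \<open>The convergent sequence is bounded; the maximum with 1 below secures
      \<open>1 \<le> C\<close>.\<close>
    have "Bseq (\<lambda>n. real n * max_box_prob (P n) (B n) (X n))"
      using lim_max by (intro convergent_imp_Bseq convergentI)
    then obtain K where K: "\<And>n. norm (real n * max_box_prob (P n) (B n) (X n)) \<le> K"
      unfolding Bseq_def by blast
    have "real n * pmf (q n) m \<le> max 1 K" if "n \<ge> 1" for n m
    proof -
      have "real n * pmf (q n) m \<le> real n * max_box_prob (P n) (B n) (X n)"
        by (intro mult_left_mono le_max that) simp
      also have "\<dots> \<le> K" using K[of n] by simp
      finally show ?thesis by simp
    qed
    then show ?thesis by (intro that[of "max 1 K"]) auto
  qed
  define \<mu> where "\<mu> n = real n * intensity (q n) r n" for n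
  have \<mu>: "filterlim \<mu> at_top sequentially"
    using lim_moment
  proof (rule filterlim_mono_eventually)
    show "\<forall>\<^sub>F n in sequentially. real n ^ (r + 1) * box_prob_moment (P n) (X n) r = \<mu> n"
      using eventually_ge_at_top[of 1] by eventually_elim (simp only: moment \<mu>_def)
  qed auto
  \<comment> \<open>Nothing is assumed about row 0, whereas the continuity theorem asks for a
    distribution at every index; a dummy is inserted there.\<close>
  define M where "M n = (if n = 0 then std_normal_distribution else distr (P n) borel (Z n))" for n
  have Zmeas: "Z n \<in> borel_measurable (P n)" if n: "n \<ge> 1" for n
    unfolding Z_def by (rule standardized_overflow(1)[OF prob[OF n] XB[OF n] row[OF n] law[OF n]])
  have "weak_conv_m M std_normal_distribution"
  proof (rule levy_continuity)
    show "real_distribution (M n)" for n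
      unfolding M_def using Zmeas[of n] prob[of n] real_dist_normal_dist
      by (auto intro: prob_space.real_distribution_distr)
    show "real_distribution std_normal_distribution"
      by (rule real_dist_normal_dist)
    fix t
    define K c where "K = exp (4 * C)" and "c = exp (- (12 * C)) / (16 * (2 * real r) ^ r)"
    define D where "D = t\<^sup>2 * (sqrt (32 * K) / c) + \<bar>t\<bar> ^ 3 * (K / (2 * (c * sqrt c)))"
    have "\<forall>\<^sub>F n in sequentially. norm (char (M n) t - of_real (exp (- (t\<^sup>2 / 2)))) \<le> D / sqrt (\<mu> n)"
      using eventually_ge_at_top[of 1] eventually_ge_at_top[of "nat \<lceil>4 * C\<rceil>"]
        eventually_ge_at_top[of "2 * r"] filterlim_at_top_dense[THEN iffD1, OF \<mu>, rule_format, of 0]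
    proof eventually_elim
      case (elim n)
      have n: "4 * C \<le> real n" "2 * real r \<le> real n"
        using elim(2,3) by linarith+
      have "char (M n) t = (\<integral>x. iexp (t * ((excess r n x - (\<integral>x. excess r n x \<partial>measure_pmf (iid (q n) 0 n)))
          / sqrt (measure_pmf.variance (iid (q n) 0 n) (excess r n)))) \<partial>measure_pmf (iid (q n) 0 n))"
        using elim(1) standardized_overflow(2)[OF prob XB row law, of n]
        by (simp add: M_def Z_def)
      then show ?case
        using excess_char_bound[OF C(1) C(2)[OF elim(1)] n r, of 0 t] elim(4)
        by (simp only: \<mu>_def D_def K_def c_def)
    qed
    moreover have "(\<lambda>n. D / sqrt (\<mu> n)) \<longlonglongrightarrow> 0"
      by (rule tendsto_divide_0[OF tendsto_const])
        (rule filterlim_at_top_imp_at_infinity, rule filterlim_compose[OF sqrt_at_top \<mu>])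
    ultimately have "(\<lambda>n. char (M n) t - of_real (exp (- (t\<^sup>2 / 2)))) \<longlonglongrightarrow> 0"
      by (rule Lim_null_comparison)
    then show "(\<lambda>n. char (M n) t) \<longlonglongrightarrow> char std_normal_distribution t"
      by (simp add: char_std_normal_distribution Lim_null[symmetric])
  qed
  then have "weak_conv_m (\<lambda>n. distr (P n) borel (Z n)) std_normal_distribution"
    unfolding weak_conv_m_def weak_conv_def
  proof (intro allI impI)
    fix x
    assume *: "\<forall>x. isCont (cdf std_normal_distribution) x \<longrightarrow>
        (\<lambda>n. cdf (M n) x) \<longlonglongrightarrow> cdf std_normal_distribution x"
      and x: "isCont (cdf std_normal_distribution) x"
    \<comment> \<open>The dummy at index 0 does not affect the limit.\<close>
    have ev: "\<forall>\<^sub>F n in sequentially. cdf (M n) x = cdf (distr (P n) borel (Z n)) x"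
      using eventually_ge_at_top[of 1] by eventually_elim (simp add: M_def)
    show "(\<lambda>n. cdf (distr (P n) borel (Z n)) x) \<longlonglongrightarrow> cdf std_normal_distribution x"
      by (rule Lim_transform_eventually[OF *[rule_format, OF x] ev])
  qed
  then show ?thesis
    unfolding Z_def .
qed

end
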